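(* Let $I\subseteq\Lambda$ be translation congruent with a subset of the unit interval $[0,1]$, and fix lattice parameters $\alpha,\beta>0$. For each $g\in L^2(I\times\mathbb{R})$, the conditions (i) $g$ is a Gabor field over $I$ with lattice parameters $\alpha$ and $\beta$, and (ii) $\widehat{\mathcal T}(g,\alpha,\beta)=\{\hat T_{k,l,m}g: k\in\alpha\mathbb{Z},\ l\in\beta\mathbb{Z},\ m\in\mathbb{Z}\}$ is a Parseval frame for $L^2(I\times\mathbb{R})$, are equivalent.
   Context: All sets and functions are Lebesgue measurable, and sets whose symmetric difference has Lebesgue measure zero are identified. $\Lambda=\mathbb{R}\setminus\{0\}$, and $L^2(I\times\mathbb{R})$ is taken with respect to the measure $|\lambda|\,d\lambda\,dt$. A system $\{\psi_j\}_{j\in J}$ in a separable Hilbert space $\mathcal{H}$ is a Parseval frame for $\mathcal{H}$ if $\|f\|^2=\sum_{j\in J}|\langle f,\psi_j\rangle|^2$ for all $f\in\mathcal{H}$. For $k\in\alpha\mathbb{Z}$, $l\in\beta\mathbb{Z}$, $m\in\mathbb{Z}$: $\hat T_{k,l,m}g(\lambda,t)=e^{2\pi i\lambda m}e^{-2\pi i\lambda l t}g(\lambda,t-k)$. $g\in L^2(I\times\mathbb{R})$ is a Gabor field over $I$ with lattice parameters $\alpha,\beta$ if for a.e. $\lambda\in I$ the system $\{t\mapsto|\lambda|^{1/2}e^{-2\pi i\lambda l t}g(\lambda,t-k): k\in\alpha\mathbb{Z}, l\in\beta\mathbb{Z}\}$ is a Parseval frame for $L^2(\mathbb{R})$. Subsets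 $I,J$ of $\mathbb{R}$ are translation congruent if there is a bijection $\tau:I\to J$ and an integer-valued (measurable) function $k$ on $I$ with $\tau(\lambda)=\lambda+k(\lambda)$. *)

theory Defs
  imports "HOL-Analysis.Analysis"
begin

text \<open>
  The Hilbert space L2(M) is represented by its square-integrable functions, without passing
  to classes modulo almost everywhere equality: the inner product and the norm depend only on
  the class. A function matters only through its values on the space of \<open>M\<close>.
\<close>

definition L2_space :: "'a measure \<Rightarrow> ('a \<Rightarrow> complex) set" where
  "L2_space M = {f \<in> borel_measurable M. integrable M (\<lambda>x. (cmod (f x))\<^sup>2)}"

definition L2_inner :: "'a measure \<Rightarrow> ('a \<Rightarrow> complex) \<Rightarrow> ('a \<Rightarrow> complex) \<Rightarrow> complex" where
  "L2_inner M f g = (\<integral>x. f x * cnj (g x) \<partial>M)"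

definition L2_norm :: "'a measure \<Rightarrow> ('a \<Rightarrow> complex) \<Rightarrow> real" where
  "L2_norm M f = sqrt (\<integral>x. (cmod (f x))\<^sup>2 \<partial>M)"

text \<open>
  A system is an indexed family, so repeated members count with multiplicity. The relation
  \<open>has_sum\<close> includes convergence; an equation with \<open>infsum\<close> would not, since a divergent
  \<open>infsum\<close> is 0.
\<close>

definition parseval_frame :: "'a measure \<Rightarrow> 'j set \<Rightarrow> ('j \<Rightarrow> 'a \<Rightarrow> complex) \<Rightarrow> bool" where
  "parseval_frame M J \<psi> \<longleftrightarrow>
     (\<forall>j\<in>J. \<psi> j \<in> L2_space M) \<and>
     (\<forall>f\<in>L2_space M. ((\<lambda>j. (cmod (L2_inner M f (\<psi> j)))\<^sup>2) has_sum (L2_norm M f)\<^sup>2) J)"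

definition int_multiples :: "real \<Rightarrow> real set" where
  "int_multiples a = range (\<lambda>n::int. a * of_int n)"

text \<open>In pairs \<open>(s, t)\<close> the first component \<open>s\<close> is the frequency variable in \<open>I\<close>.\<close>

definition weighted_strip :: "real set \<Rightarrow> (real \<times> real) measure" where
  "weighted_strip I = density (lebesgue_on (I \<times> UNIV)) (\<lambda>(s, t). ennreal \<bar>s\<bar>)"

definition T_hat ::
  "real \<Rightarrow> real \<Rightarrow> int \<Rightarrow> (real \<times> real \<Rightarrow> complex) \<Rightarrow> real \<times> real \<Rightarrow> complex" where
  "T_hat k l m g = (\<lambda>(s, t).
     exp (2 * pi * \<i> * s * of_int m) * exp (- 2 * pi * \<i> * s * l * t) * g (s, t - k))"

definition gabor_field :: "real set \<Rightarrow> real \<Rightarrow> real \<Rightarrow> (real \<times> real \<Rightarrow> complex) \<Rightarrow> bool" where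
  "gabor_field I \<alpha> \<beta> g \<longleftrightarrow>
     g \<in> L2_space (weighted_strip I) \<and>
     (AE s in lebesgue_on I.
        parseval_frame (lebesgue :: real measure) (int_multiples \<alpha> \<times> int_multiples \<beta>)
          (\<lambda>(k, l) t. sqrt \<bar>s\<bar> * exp (- 2 * pi * \<i> * s * l * t) * g (s, t - k)))"

text \<open>
  Sets differing by a Lebesgue null set are identified, hence \<open>\<tau>\<close> is only required to be a
  bijection between suitable representatives \<open>I'\<close> and \<open>J'\<close>.
\<close>

definition translation_congruent :: "real set \<Rightarrow> real set \<Rightarrow> bool" where
  "translation_congruent I J \<longleftrightarrow>
     (\<exists>I'\<in>sets lebesgue. \<exists>J'\<in>sets lebesgue. \<exists>\<tau> (k :: real \<Rightarrow> int).
        sym_diff I I' \<in> null_sets lebesgue \<and> sym_diff J J' \<in> null_sets lebesgue \<and>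
        bij_betw \<tau> I' J' \<and>
        k \<in> measurable (lebesgue_on I') (count_space UNIV) \<and>
        (\<forall>s\<in>I'. \<tau> s = s + of_int (k s)))"

end

theory Submission
  imports Defs
begin

text \<open>
  Multiplication by \<open>sqrt \<bar>s\<bar>\<close> identifies the weighted space over the strip with the
  unweighted L2 space of \<open>I \<times> \<real>\<close>. It turns the system of all \<open>T_hat k l m g\<close> into the
  products \<open>fourier_char m s * \<Psi> (k, l) (s, t)\<close>, where \<open>fourier_char m s\<close> is the exponential
  of \<open>2 \<pi> i s m\<close> and the functions \<open>\<Psi> (k, l) (s, \<sqdot>)\<close> are precisely the members of the fibre
  system at \<open>s\<close> in the definition of a Gabor field. So the index \<open>m\<close> enters only through a
  character of the frequency variable, and the statement is a case of a general principle about
  systems \<open>e k s * \<Psi> j (s, t)\<close>, proved in the locale \<open>fibered_system\<close>.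

  The principle rests on one identity. Let \<open>c j s\<close> be the inner product of the slice
  \<open>f (s, \<sqdot>)\<close> with \<open>\<Psi> j (s, \<sqdot>)\<close>. By Fubini, the inner product of \<open>f\<close> with the member of
  index \<open>(j, k)\<close> is the inner product of \<open>c j\<close> with \<open>e k\<close> on \<open>I\<close>. If the \<open>e k\<close> form a
  Parseval frame of L2 over \<open>I\<close> and every \<open>c j\<close> is square integrable, summing over \<open>k\<close>
  first shows that the sum of all squared coefficients of \<open>f\<close> is the integral over \<open>I\<close> of
  the sum over \<open>j\<close> of \<open>\<bar>c j s\<bar>\<^sup>2\<close> (lemma \<open>total_energy\<close>).

  If almost every fibre system is a Parseval frame, the inner sum is the squared norm of the
  slice, and Tonelli gives the squared norm of \<open>f\<close>. Conversely, the Parseval identity for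
  \<open>f (s, t) = indicator A s * h t\<close>, for all measurable subsets \<open>A\<close> of \<open>I\<close>, says that two
  densities have the same integrals, so the Parseval identity of the fibre holds for \<open>h\<close> at
  almost every \<open>s\<close>. The exceptional null set depends on \<open>h\<close>. Since L2 of the line has a
  countable dense subset and a Parseval identity extends from a dense set to the whole space
  (lemma \<open>parseval_frame_if_dense\<close>), one null set serves all \<open>h\<close>.

  Translation congruence provides the Parseval frame on \<open>I\<close>. The characters are one on the
  unit interval, by density of the trigonometric polynomials. A Parseval frame restricts to
  measurable subsets, and the characters are unchanged by integer translations, so the
  property passes from the subset of the unit interval back to \<open>I\<close>.
\<close>

section \<open>Square-integrable functions\<close>

lemma L2_space_iff_nn_integral:
  "f \<in> L2_space M \<longleftrightarrow> f \<in> borel_measurable M \<and> (\<integral>\<^sup>+x. ennreal ((cmod (f x))\<^sup>2) \<partial>M) < \<infinity>"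
  by (auto simp: L2_space_def integrable_iff_bounded)

lemma L2_space_measurable: "f \<in> L2_space M \<Longrightarrow> f \<in> borel_measurable M"
  by (simp add: L2_space_def)

lemma L2_space_integrable: "f \<in> L2_space M \<Longrightarrow> integrable M (\<lambda>x. (cmod (f x))\<^sup>2)"
  by (simp add: L2_space_def)

lemma L2_norm_nonneg [simp]: "0 \<le> L2_norm M f"
  by (simp add: L2_norm_def)

lemma L2_norm_squared: "(L2_norm M f)\<^sup>2 = (\<integral>x. (cmod (f x))\<^sup>2 \<partial>M)"
  by (simp add: L2_norm_def)

lemma nn_integral_L2:
  assumes "f \<in> L2_space M"
  shows "(\<integral>\<^sup>+x. ennreal ((cmod (f x))\<^sup>2) \<partial>M) = ennreal ((L2_norm M f)\<^sup>2)"
  unfolding L2_norm_squared using assms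
  by (intro nn_integral_eq_integral L2_space_integrable) auto

lemma L2_spaceI_bound:
  assumes f: "f \<in> borel_measurable M" and w: "integrable M w"
    and le: "AE x in M. (cmod (f x))\<^sup>2 \<le> w x"
  shows "f \<in> L2_space M"
proof -
  have "integrable M (\<lambda>x. (cmod (f x))\<^sup>2)"
    using f le by (intro Bochner_Integration.integrable_bound[OF w]) auto
  then show ?thesis using f by (simp add: L2_space_def)
qed

lemma L2_space_bounded_mult:
  assumes f: "f \<in> L2_space M" and u: "u \<in> borel_measurable M"
    and le: "\<And>x. x \<in> space M \<Longrightarrow> cmod (u x) \<le> 1"
  shows "(\<lambda>x. u x * f x) \<in> L2_space M"
proof (rule L2_spaceI_bound[OF _ L2_space_integrable[OF f]])
  show "(\<lambda>x. u x * f x) \<in> borel_measurable M"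
    using L2_space_measurable[OF f] u by simp
  have "(cmod (u x * f x))\<^sup>2 \<le> (cmod (f x))\<^sup>2" if "x \<in> space M" for x
    using le[OF that] by (intro power_mono) (auto simp: norm_mult intro: mult_left_le_one_le)
  then show "AE x in M. (cmod (u x * f x))\<^sup>2 \<le> (cmod (f x))\<^sup>2" by simp
qed

lemma L2_space_add:
  assumes f: "f \<in> L2_space M" and g: "g \<in> L2_space M"
  shows "(\<lambda>x. f x + g x) \<in> L2_space M"
proof (rule L2_spaceI_bound)
  show "(\<lambda>x. f x + g x) \<in> borel_measurable M"
    using L2_space_measurable[OF f] L2_space_measurable[OF g] by simp
  show "integrable M (\<lambda>x. 2 * (cmod (f x))\<^sup>2 + 2 * (cmod (g x))\<^sup>2)"
    using L2_space_integrable[OF f] L2_space_integrable[OF g] by simp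
  have "(cmod (f x + g x))\<^sup>2 \<le> 2 * (cmod (f x))\<^sup>2 + 2 * (cmod (g x))\<^sup>2" for x
  proof -
    have "(cmod (f x + g x))\<^sup>2 \<le> (cmod (f x) + cmod (g x))\<^sup>2"
      by (intro power_mono norm_triangle_ineq) auto
    also have "\<dots> \<le> 2 * (cmod (f x))\<^sup>2 + 2 * (cmod (g x))\<^sup>2"
      using zero_le_power2[of "cmod (f x) - cmod (g x)"] by (simp add: power2_sum power2_diff)
    finally show ?thesis .
  qed
  then show "AE x in M. (cmod (f x + g x))\<^sup>2 \<le> 2 * (cmod (f x))\<^sup>2 + 2 * (cmod (g x))\<^sup>2" by simp
qed

lemma L2_space_scale:
  assumes f: "f \<in> L2_space M"
  shows "(\<lambda>x. c * f x) \<in> L2_space M"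
  using f by (auto simp: L2_space_def norm_mult power_mult_distrib)

lemma L2_space_diff:
  assumes f: "f \<in> L2_space M" and g: "g \<in> L2_space M"
  shows "(\<lambda>x. f x - g x) \<in> L2_space M"
  using L2_space_add[OF f L2_space_scale[OF g, of "-1"]] by simp

lemma L2_space_cong_AE:
  assumes f: "f \<in> L2_space M" and g: "g \<in> borel_measurable M" and "AE x in M. f x = g x"
  shows "g \<in> L2_space M"
  using assms(3) by (intro L2_spaceI_bound[OF g L2_space_integrable[OF f]]) auto

lemma borel_measurable_cnj [measurable (raw)]:
  "f \<in> borel_measurable M \<Longrightarrow> (\<lambda>x. cnj (f x)) \<in> borel_measurable M"
  by (rule borel_measurable_continuous_on[of cnj]) (auto intro: continuous_intros)

text \<open>
  Stated for the integral of the modulus, Cauchy-Schwarz yields integrability of the product, the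
  bound for the inner product and the triangle inequality at once.
\<close>

lemma nn_integral_L2_product:
  assumes f: "f \<in> L2_space M" and g: "g \<in> L2_space M"
  shows "(\<integral>\<^sup>+x. ennreal (cmod (f x * cnj (g x))) \<partial>M) \<le> ennreal (L2_norm M f * L2_norm M g)"
proof -
  have [measurable]: "f \<in> borel_measurable M" "g \<in> borel_measurable M"
    using f g by (auto simp: L2_space_def)
  have "(\<integral>\<^sup>+x. ennreal (cmod (f x)) * ennreal (cmod (g x)) \<partial>M)\<^sup>2 \<le>
    (\<integral>\<^sup>+x. (ennreal (cmod (f x)))\<^sup>2 \<partial>M) * (\<integral>\<^sup>+x. (ennreal (cmod (g x)))\<^sup>2 \<partial>M)"
    by (rule Cauchy_Schwarz_nn_integral) auto
  also have "\<dots> = (ennreal (L2_norm M f * L2_norm M g))\<^sup>2"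
    using nn_integral_L2[OF f] nn_integral_L2[OF g]
    by (simp add: ennreal_power power_mult_distrib flip: ennreal_mult)
  finally have sq: "(\<integral>\<^sup>+x. ennreal (cmod (f x)) * ennreal (cmod (g x)) \<partial>M)\<^sup>2
    \<le> (ennreal (L2_norm M f * L2_norm M g))\<^sup>2" .
  have "(\<integral>\<^sup>+x. ennreal (cmod (f x)) * ennreal (cmod (g x)) \<partial>M) \<le> ennreal (L2_norm M f * L2_norm M g)"
  proof (cases "\<integral>\<^sup>+x. ennreal (cmod (f x)) * ennreal (cmod (g x)) \<partial>M" rule: ennreal_cases)
    case (real r)
    then have "r\<^sup>2 \<le> (L2_norm M f * L2_norm M g)\<^sup>2"
      using sq by (simp add: ennreal_power)
    then have "r \<le> L2_norm M f * L2_norm M g"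
      by (rule power2_le_imp_le) simp
    then show ?thesis using real by simp
  next
    case top
    then show ?thesis using sq by (simp add: ennreal_power top_unique)
  qed
  then show ?thesis by (simp add: norm_mult ennreal_mult)
qed

lemma integrable_L2_product:
  assumes f: "f \<in> L2_space M" and g: "g \<in> L2_space M"
  shows "integrable M (\<lambda>x. f x * cnj (g x))"
proof -
  have [measurable]: "f \<in> borel_measurable M" "g \<in> borel_measurable M"
    using f g by (auto simp: L2_space_def)
  show ?thesis
    unfolding integrable_iff_bounded
    using nn_integral_L2_product[OF f g] by (auto simp: order_le_less_trans)
qed

lemma L2_Cauchy_Schwarz:
  assumes f: "f \<in> L2_space M" and g: "g \<in> L2_space M"
  shows "cmod (L2_inner M f g) \<le> L2_norm M f * L2_norm M g"
proof -
  have "ennreal (cmod (L2_inner M f g)) \<le> (\<integral>\<^sup>+x. ennreal (cmod (f x * cnj (g x))) \<partial>M)"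
    unfolding L2_inner_def by (rule integral_norm_bound_ennreal[OF integrable_L2_product[OF f g]])
  also have "\<dots> \<le> ennreal (L2_norm M f * L2_norm M g)"
    by (rule nn_integral_L2_product[OF f g])
  finally show ?thesis by simp
qed

lemma L2_inner_add_left:
  assumes "f \<in> L2_space M" "g \<in> L2_space M" "h \<in> L2_space M"
  shows "L2_inner M (\<lambda>x. f x + g x) h = L2_inner M f h + L2_inner M g h"
  using assms by (simp add: L2_inner_def distrib_right integrable_L2_product)

lemma L2_inner_scale_left: "L2_inner M (\<lambda>x. c * f x) h = c * L2_inner M f h"
  by (simp add: L2_inner_def mult.assoc)

lemma L2_norm_scale: "L2_norm M (\<lambda>x. c * f x) = cmod c * L2_norm M f"
  by (simp add: L2_norm_def norm_mult power_mult_distrib real_sqrt_mult)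

lemma L2_norm_minus_commute: "L2_norm M (\<lambda>x. f x - g x) = L2_norm M (\<lambda>x. g x - f x)"
  by (simp add: L2_norm_def norm_minus_commute)

lemma L2_norm_triangle:
  assumes f: "f \<in> L2_space M" and g: "g \<in> L2_space M"
  shows "L2_norm M (\<lambda>x. f x + g x) \<le> L2_norm M f + L2_norm M g"
proof -
  have fg: "integrable M (\<lambda>x. cmod (f x * cnj (g x)))"
    using integrable_L2_product[OF f g] by simp
  have prod: "(\<integral>x. cmod (f x * cnj (g x)) \<partial>M) \<le> L2_norm M f * L2_norm M g"
  proof -
    have "ennreal (\<integral>x. cmod (f x * cnj (g x)) \<partial>M) \<le> ennreal (L2_norm M f * L2_norm M g)"
      using nn_integral_L2_product[OF f g] nn_integral_eq_integral[OF fg] by simp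
    then show ?thesis by simp
  qed
  have "(L2_norm M (\<lambda>x. f x + g x))\<^sup>2 \<le>
      (\<integral>x. (cmod (f x))\<^sup>2 + 2 * cmod (f x * cnj (g x)) + (cmod (g x))\<^sup>2 \<partial>M)"
    unfolding L2_norm_squared
  proof (rule integral_mono)
    show "integrable M (\<lambda>x. (cmod (f x + g x))\<^sup>2)"
      by (rule L2_space_integrable[OF L2_space_add[OF f g]])
    show "integrable M (\<lambda>x. (cmod (f x))\<^sup>2 + 2 * cmod (f x * cnj (g x)) + (cmod (g x))\<^sup>2)"
      using fg L2_space_integrable[OF f] L2_space_integrable[OF g] by auto
    fix x
    have "(cmod (f x + g x))\<^sup>2 \<le> (cmod (f x) + cmod (g x))\<^sup>2"
      by (intro power_mono norm_triangle_ineq) auto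
    then show "(cmod (f x + g x))\<^sup>2 \<le> (cmod (f x))\<^sup>2 + 2 * cmod (f x * cnj (g x)) + (cmod (g x))\<^sup>2"
      by (simp add: power2_sum norm_mult)
  qed
  also have "\<dots> = (L2_norm M f)\<^sup>2 + 2 * (\<integral>x. cmod (f x * cnj (g x)) \<partial>M) + (L2_norm M g)\<^sup>2"
    using fg L2_space_integrable[OF f] L2_space_integrable[OF g] by (simp add: L2_norm_squared)
  also have "\<dots> \<le> (L2_norm M f + L2_norm M g)\<^sup>2"
    using prod by (simp add: power2_sum)
  finally show ?thesis
    by (rule power2_le_imp_le) simp
qed

lemma L2_norm_triangle_diff:
  assumes f: "f \<in> L2_space M" and g: "g \<in> L2_space M"
  shows "L2_norm M f \<le> L2_norm M g + L2_norm M (\<lambda>x. f x - g x)"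
  using L2_norm_triangle[OF g L2_space_diff[OF f g]] by simp

text \<open>
  Summation as an integral against counting measure: this gives access to Tonelli's theorem for
  interchanging sums with each other and with integrals.
\<close>

lemma has_sum_iff_nn_integral_count_space:
  fixes f :: "'a \<Rightarrow> real"
  assumes nonneg: "\<And>x. x \<in> A \<Longrightarrow> 0 \<le> f x" and y: "0 \<le> y"
  shows "(f has_sum y) A \<longleftrightarrow> (\<integral>\<^sup>+x. ennreal (f x) \<partial>count_space A) = ennreal y"
proof
  assume s: "(f has_sum y) A"
  have "f summable_on A" using s by (auto simp: summable_on_def)
  then have "(\<lambda>x. norm (f x)) summable_on A"
    using nonneg by (subst summable_on_cong[where g = f]) auto
  then have a: "Infinite_Set_Sum.abs_summable_on f A"
    using abs_summable_equivalent[of f A] by simp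
  have "integral\<^sup>L (count_space A) f = y"
    using infsetsum_infsum[OF a] infsumI[OF s] by (simp add: infsetsum_def)
  moreover have "integrable (count_space A) f"
    using a by (simp add: abs_summable_on_def)
  ultimately show "(\<integral>\<^sup>+x. ennreal (f x) \<partial>count_space A) = ennreal y"
    using nonneg by (subst nn_integral_eq_integral) (auto simp: AE_count_space)
next
  assume n: "(\<integral>\<^sup>+x. ennreal (f x) \<partial>count_space A) = ennreal y"
  have i: "integrable (count_space A) f"
    using nonneg n by (intro integrableI_nonneg) (auto simp: AE_count_space)
  then have a: "Infinite_Set_Sum.abs_summable_on f A" by (simp add: abs_summable_on_def)
  have "ennreal (integral\<^sup>L (count_space A) f) = ennreal y"
    using n nn_integral_eq_integral[OF i] nonneg by (auto simp: AE_count_space)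
  moreover have "0 \<le> integral\<^sup>L (count_space A) f"
    using nonneg by (intro integral_nonneg_AE) (auto simp: AE_count_space)
  ultimately have "infsum f A = y"
    using infsetsum_infsum[OF a] y by (simp add: infsetsum_def)
  moreover have "f summable_on A"
    using a abs_summable_equivalent abs_summable_summable by blast
  ultimately show "(f has_sum y) A" by (metis has_sum_infsum)
qed

section \<open>Extending Parseval identities from dense sets\<close>

definition L2_dense :: "'a measure \<Rightarrow> ('a \<Rightarrow> complex) set \<Rightarrow> bool" where
  "L2_dense M D \<longleftrightarrow> D \<subseteq> L2_space M \<and>
     (\<forall>f\<in>L2_space M. \<forall>\<epsilon>>0. \<exists>d\<in>D. L2_norm M (\<lambda>x. f x - d x) < \<epsilon>)"

text \<open>
  On a dense set the identity gives Bessel's inequality for finite subsets of the index set. Finite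
  partial sums depend continuously on the function, so Bessel's inequality extends to all of L2.
  It makes the coefficient map contractive, uniformly in the finite subset; hence the lower bound
  for the partial sums survives approximation as well.
\<close>

lemma parseval_frame_if_dense:
  assumes \<psi>: "\<And>j. j \<in> J \<Longrightarrow> \<psi> j \<in> L2_space M"
    and D: "L2_dense M D"
    and parseval: "\<And>d. d \<in> D \<Longrightarrow>
      ((\<lambda>j. (cmod (L2_inner M d (\<psi> j)))\<^sup>2) has_sum (L2_norm M d)\<^sup>2) J"
  shows "parseval_frame M J \<psi>"
proof -
  define N where "N f S = L2_set (\<lambda>j. cmod (L2_inner M f (\<psi> j))) S" for f S
  have N_nonneg: "0 \<le> N f S" for f S by (simp add: N_def)
  have N_squared: "(N f S)\<^sup>2 = (\<Sum>j\<in>S. (cmod (L2_inner M f (\<psi> j)))\<^sup>2)" for f S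
    by (simp add: N_def L2_set_def sum_nonneg)
  have D_sub: "d \<in> L2_space M" if "d \<in> D" for d using D that by (auto simp: L2_dense_def)
  have approx: "\<exists>d\<in>D. L2_norm M (\<lambda>x. f x - d x) < \<epsilon>" if "f \<in> L2_space M" "\<epsilon> > 0" for f \<epsilon>
    using D that by (auto simp: L2_dense_def)
  \<comment> \<open>The l2 norm of the coefficients on a finite index set is a seminorm in the function.\<close>
  have N_add: "N (\<lambda>x. f x + g x) S \<le> N f S + N g S"
    if "f \<in> L2_space M" "g \<in> L2_space M" "S \<subseteq> J" for f g S
  proof -
    have "N (\<lambda>x. f x + g x) S \<le>
        L2_set (\<lambda>j. cmod (L2_inner M f (\<psi> j)) + cmod (L2_inner M g (\<psi> j))) S"
      unfolding N_def
    proof (rule L2_set_mono)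
      fix j assume "j \<in> S"
      then have "\<psi> j \<in> L2_space M" using \<psi> that by auto
      then show "cmod (L2_inner M (\<lambda>x. f x + g x) (\<psi> j)) \<le>
          cmod (L2_inner M f (\<psi> j)) + cmod (L2_inner M g (\<psi> j))"
        using L2_inner_add_left[OF that(1,2)] norm_triangle_ineq by metis
    qed auto
    also have "\<dots> \<le> N f S + N g S" unfolding N_def by (rule L2_set_triangle_ineq)
    finally show ?thesis .
  qed
  have Bessel_D: "N d S \<le> L2_norm M d" if "d \<in> D" "finite S" "S \<subseteq> J" for d S
  proof -
    have "(N d S)\<^sup>2 \<le> (L2_norm M d)\<^sup>2"
      unfolding N_squared
      using parseval[OF that(1)] that(2,3) by (intro has_sum_mono_neutral[OF has_sum_finite]) auto
    then show ?thesis by (rule power2_le_imp_le) simp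
  qed
  have Bessel: "N f S \<le> L2_norm M f" if f: "f \<in> L2_space M" and S: "finite S" "S \<subseteq> J" for f S
  proof (rule field_le_epsilon)
    fix \<delta> :: real assume "\<delta> > 0"
    \<comment> \<open>Here the closeness may depend on \<open>S\<close>, as no bound uniform in \<open>S\<close> is known yet.\<close>
    define C where "C = 1 + (\<Sum>j\<in>S. L2_norm M (\<psi> j))"
    have C: "C \<ge> 1" by (simp add: C_def sum_nonneg)
    obtain d where d: "d \<in> D" and close: "L2_norm M (\<lambda>x. f x - d x) < \<delta> / C"
      using approx[OF f, of "\<delta> / C"] \<open>\<delta> > 0\<close> C by auto
    note fd = L2_space_diff[OF f D_sub[OF d]]
    have "N (\<lambda>x. f x - d x) S \<le> (\<Sum>j\<in>S. cmod (L2_inner M (\<lambda>x. f x - d x) (\<psi> j)))"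
      unfolding N_def by (rule L2_set_le_sum) auto
    also have "\<dots> \<le> (\<Sum>j\<in>S. L2_norm M (\<lambda>x. f x - d x) * L2_norm M (\<psi> j))"
      using S by (intro sum_mono L2_Cauchy_Schwarz fd \<psi>) auto
    finally have "N (\<lambda>x. f x - d x) S \<le> L2_norm M (\<lambda>x. f x - d x) * (C - 1)"
      by (simp add: C_def sum_distrib_left)
    moreover have "N f S \<le> N d S + N (\<lambda>x. f x - d x) S"
      using N_add[OF D_sub[OF d] fd S(2)] by simp
    moreover have "L2_norm M d \<le> L2_norm M f + L2_norm M (\<lambda>x. f x - d x)"
      using L2_norm_triangle_diff[OF D_sub[OF d] f] by (simp only: L2_norm_minus_commute[of M f d])
    ultimately have "N f S \<le> L2_norm M f + L2_norm M (\<lambda>x. f x - d x) * C"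
      using Bessel_D[OF d S] by (simp add: algebra_simps)
    also have "\<dots> \<le> L2_norm M f + \<delta>"
      using close C by (simp add: field_simps)
    finally show "N f S \<le> L2_norm M f + \<delta>" .
  qed
  have lower: "\<exists>S. finite S \<and> S \<subseteq> J \<and> L2_norm M f - \<delta> < N f S"
    if f: "f \<in> L2_space M" and "\<delta> > 0" for f \<delta>
  proof -
    \<comment> \<open>One third is lost in passing from \<open>f\<close> to \<open>d\<close> in the norm, one in truncating the sum for
      \<open>d\<close>, and one, by Bessel, in passing back to \<open>f\<close> in the coefficients.\<close>
    obtain d where d: "d \<in> D" and close: "L2_norm M (\<lambda>x. f x - d x) < \<delta> / 3"
      using approx[OF f, of "\<delta> / 3"] \<open>\<delta> > 0\<close> by auto
    note df = L2_space_diff[OF D_sub[OF d] f]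
    have "\<exists>S. finite S \<and> S \<subseteq> J \<and> L2_norm M d - \<delta> / 3 < N d S"
    proof (cases "L2_norm M d - \<delta> / 3 < 0")
      case True
      then show ?thesis using N_nonneg[of d "{}"] by (intro exI[of _ "{}"]) auto
    next
      case False
      then have "(L2_norm M d - \<delta> / 3)\<^sup>2 < (L2_norm M d)\<^sup>2"
        using \<open>\<delta> > 0\<close> by (intro power_strict_mono) auto
      then have "\<forall>\<^sub>F S in finite_subsets_at_top J.
          (L2_norm M d - \<delta> / 3)\<^sup>2 < (\<Sum>j\<in>S. (cmod (L2_inner M d (\<psi> j)))\<^sup>2)"
        using parseval[OF d] unfolding has_sum_def by (rule order_tendstoD(1)[rotated])
      then obtain S where "finite S" "S \<subseteq> J" "(L2_norm M d - \<delta> / 3)\<^sup>2 < (N d S)\<^sup>2"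
        unfolding eventually_finite_subsets_at_top N_squared by auto
      then show ?thesis
        using N_nonneg by (meson power_less_imp_less_base)
    qed
    then obtain S where S: "finite S" "S \<subseteq> J" "L2_norm M d - \<delta> / 3 < N d S" by auto
    have "N d S \<le> N f S + N (\<lambda>x. d x - f x) S"
      using N_add[OF f df S(2)] by simp
    moreover have "N (\<lambda>x. d x - f x) S \<le> L2_norm M (\<lambda>x. f x - d x)"
      using Bessel[OF df S(1,2)] by (simp only: L2_norm_minus_commute[of M f d])
    ultimately show ?thesis
      using S close L2_norm_triangle_diff[OF f D_sub[OF d]] by (intro exI[of _ S]) auto
  qed
  have "((\<lambda>j. (cmod (L2_inner M f (\<psi> j)))\<^sup>2) has_sum (L2_norm M f)\<^sup>2) J"
    if f: "f \<in> L2_space M" for f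
    unfolding has_sum_def
  proof (rule increasing_tendsto)
    have "(N f S)\<^sup>2 \<le> (L2_norm M f)\<^sup>2" if "finite S" "S \<subseteq> J" for S
      using Bessel[OF f that] by (intro power_mono N_nonneg)
    then show "\<forall>\<^sub>F S in finite_subsets_at_top J.
        (\<Sum>j\<in>S. (cmod (L2_inner M f (\<psi> j)))\<^sup>2) \<le> (L2_norm M f)\<^sup>2"
      unfolding N_squared by (auto simp: eventually_finite_subsets_at_top)
  next
    fix x assume x: "x < (L2_norm M f)\<^sup>2"
    show "\<forall>\<^sub>F S in finite_subsets_at_top J. x < (\<Sum>j\<in>S. (cmod (L2_inner M f (\<psi> j)))\<^sup>2)"
    proof (cases "x < 0")
      case True
      then show ?thesis
        by (intro always_eventually allI) (meson le_less_trans not_le sum_nonneg zero_le_power2)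
    next
      case False
      then have "sqrt x < L2_norm M f" using x by (simp add: real_less_lsqrt)
      then obtain S where S: "finite S" "S \<subseteq> J" "sqrt x < N f S"
        using lower[OF f, of "L2_norm M f - sqrt x"] by auto
      have "x < (N f T)\<^sup>2" if T: "finite T" "S \<subseteq> T" for T
      proof -
        have "x = (sqrt x)\<^sup>2" using False by simp
        also have "\<dots> < (N f S)\<^sup>2" using S(3) False by (intro power_strict_mono) auto
        also have "\<dots> \<le> (N f T)\<^sup>2" unfolding N_squared using T by (intro sum_mono2) auto
        finally show ?thesis .
      qed
      then show ?thesis
        unfolding eventually_finite_subsets_at_top N_squared using S by blast
    qed
  qed
  then show ?thesis using \<psi> by (auto simp: parseval_frame_def)
qed

section \<open>Closed subspaces containing indicator functions\<close>

text \<open>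
  Approximation is in the seminorm on functions, so a closed subspace in this sense is also closed
  under measurable changes on null sets.
\<close>

definition L2_closed_subspace :: "'a measure \<Rightarrow> ('a \<Rightarrow> complex) set \<Rightarrow> bool" where
  "L2_closed_subspace M V \<longleftrightarrow> V \<subseteq> L2_space M \<and> (\<lambda>x. 0) \<in> V \<and>
     (\<forall>f\<in>V. \<forall>g\<in>V. (\<lambda>x. f x + g x) \<in> V) \<and> (\<forall>c. \<forall>f\<in>V. (\<lambda>x. c * f x) \<in> V) \<and>
     (\<forall>f\<in>L2_space M. (\<forall>\<epsilon>>0. \<exists>v\<in>V. L2_norm M (\<lambda>x. f x - v x) < \<epsilon>) \<longrightarrow> f \<in> V)"

definition L2_closure :: "'a measure \<Rightarrow> ('a \<Rightarrow> complex) set \<Rightarrow> ('a \<Rightarrow> complex) set" where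
  "L2_closure M D = {f \<in> L2_space M. \<forall>\<epsilon>>0. \<exists>d\<in>D. L2_norm M (\<lambda>x. f x - d x) < \<epsilon>}"

lemma L2_closure_superset:
  assumes "D \<subseteq> L2_space M"
  shows "D \<subseteq> L2_closure M D"
  using assms by (auto simp: L2_closure_def L2_norm_def intro!: bexI)

text \<open>
  Closure under a dense set of scalars is enough. This covers both the trigonometric polynomials,
  with all complex scalars, and a countable set closed only under complex rationals.
\<close>

lemma L2_closed_subspace_closure:
  assumes D: "D \<subseteq> L2_space M" and zero: "(\<lambda>x. 0) \<in> D"
    and add: "\<And>f g. f \<in> D \<Longrightarrow> g \<in> D \<Longrightarrow> (\<lambda>x. f x + g x) \<in> D"
    and scale: "\<And>q f. q \<in> Q \<Longrightarrow> f \<in> D \<Longrightarrow> (\<lambda>x. q * f x) \<in> D"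
    and Q: "closure Q = UNIV"
  shows "L2_closed_subspace M (L2_closure M D)"
proof -
  let ?V = "L2_closure M D"
  have V: "f \<in> L2_space M" if "f \<in> ?V" for f using that by (simp add: L2_closure_def)
  have approx: "\<exists>d\<in>D. L2_norm M (\<lambda>x. f x - d x) < \<epsilon>" if "f \<in> ?V" "\<epsilon> > 0" for f \<epsilon>
    using that by (auto simp: L2_closure_def)
  have "(\<lambda>x. f x + g x) \<in> ?V" if f: "f \<in> ?V" and g: "g \<in> ?V" for f g
    unfolding L2_closure_def
  proof (intro CollectI conjI allI impI)
    show "(\<lambda>x. f x + g x) \<in> L2_space M" using V f g by (intro L2_space_add) auto
    fix \<epsilon> :: real assume "\<epsilon> > 0"
    then obtain d e where de: "d \<in> D" "e \<in> D"
        "L2_norm M (\<lambda>x. f x - d x) < \<epsilon> / 2" "L2_norm M (\<lambda>x. g x - e x) < \<epsilon> / 2"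
      using approx[OF f, of "\<epsilon> / 2"] approx[OF g, of "\<epsilon> / 2"] by auto
    have "L2_norm M (\<lambda>x. (f x - d x) + (g x - e x)) \<le>
        L2_norm M (\<lambda>x. f x - d x) + L2_norm M (\<lambda>x. g x - e x)"
      using V f g D de by (intro L2_norm_triangle L2_space_diff) auto
    then show "\<exists>d\<in>D. L2_norm M (\<lambda>x. f x + g x - d x) < \<epsilon>"
      using de add[OF de(1,2)] by (intro bexI[of _ "\<lambda>x. d x + e x"]) (auto simp: algebra_simps)
  qed
  moreover have "(\<lambda>x. c * f x) \<in> ?V" if f: "f \<in> ?V" for f c
    unfolding L2_closure_def
  proof (intro CollectI conjI allI impI)
    show "(\<lambda>x. c * f x) \<in> L2_space M" using V f by (intro L2_space_scale) auto
    fix \<epsilon> :: real assume \<epsilon>: "\<epsilon> > 0"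
    define r where "r = \<epsilon> / (2 * (L2_norm M f + 1))"
    have "r > 0" using \<epsilon> L2_norm_nonneg[of M f] by (auto simp: r_def intro!: divide_pos_pos add_nonneg_pos)
    then obtain q where q: "q \<in> Q" "cmod (c - q) < r"
      using Q closure_approachable[of c Q] by (auto simp: dist_norm norm_minus_commute)
    obtain d where d: "d \<in> D" "L2_norm M (\<lambda>x. f x - d x) < \<epsilon> / (2 * (cmod q + 1))"
      using approx[OF f, of "\<epsilon> / (2 * (cmod q + 1))"] \<epsilon>
      by (auto simp: add_nonneg_pos)
    have "L2_norm M (\<lambda>x. (c - q) * f x + q * (f x - d x)) \<le>
        L2_norm M (\<lambda>x. (c - q) * f x) + L2_norm M (\<lambda>x. q * (f x - d x))"
      using V f D d by (intro L2_norm_triangle L2_space_diff L2_space_scale) auto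
    also have "\<dots> = cmod (c - q) * L2_norm M f + cmod q * L2_norm M (\<lambda>x. f x - d x)"
      by (simp only: L2_norm_scale)
    also have "\<dots> < \<epsilon> / 2 + \<epsilon> / 2"
    proof (rule add_le_less_mono)
      have "cmod (c - q) * L2_norm M f \<le> r * (L2_norm M f + 1)"
        using q \<open>r > 0\<close> by (intro mult_mono) auto
      also have "\<dots> = \<epsilon> / 2"
        using add_nonneg_pos[OF L2_norm_nonneg[of M f] zero_less_one] by (simp add: r_def field_simps)
      finally show "cmod (c - q) * L2_norm M f \<le> \<epsilon> / 2" .
      have "cmod q * L2_norm M (\<lambda>x. f x - d x) \<le> (cmod q + 1) * L2_norm M (\<lambda>x. f x - d x)"
        by (intro mult_right_mono) auto
      also have "\<dots> < (cmod q + 1) * (\<epsilon> / (2 * (cmod q + 1)))"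
        using d by (intro mult_strict_left_mono) (auto simp: add_nonneg_pos)
      also have "\<dots> = \<epsilon> / 2"
        using add_nonneg_pos[OF norm_ge_zero[of q] zero_less_one] by (simp add: field_simps)
      finally show "cmod q * L2_norm M (\<lambda>x. f x - d x) < \<epsilon> / 2" .
    qed
    finally have "L2_norm M (\<lambda>x. c * f x - q * d x) < \<epsilon>"
      by (simp add: algebra_simps)
    then show "\<exists>d\<in>D. L2_norm M (\<lambda>x. c * f x - d x) < \<epsilon>"
      using scale[OF q(1) d(1)] by (intro bexI[of _ "\<lambda>x. q * d x"])
  qed
  moreover have "f \<in> ?V"
    if f: "f \<in> L2_space M" and lim: "\<forall>\<epsilon>>0. \<exists>v\<in>?V. L2_norm M (\<lambda>x. f x - v x) < \<epsilon>" for f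
    unfolding L2_closure_def
  proof (intro CollectI conjI f allI impI)
    fix \<epsilon> :: real assume \<epsilon>: "\<epsilon> > 0"
    then obtain v where v: "v \<in> ?V" "L2_norm M (\<lambda>x. f x - v x) < \<epsilon> / 2"
      using lim half_gt_zero by blast
    obtain d where d: "d \<in> D" "L2_norm M (\<lambda>x. v x - d x) < \<epsilon> / 2"
      using approx[OF v(1), of "\<epsilon> / 2"] \<epsilon> by auto
    have "L2_norm M (\<lambda>x. (f x - v x) + (v x - d x)) \<le>
        L2_norm M (\<lambda>x. f x - v x) + L2_norm M (\<lambda>x. v x - d x)"
      using V v f D d by (intro L2_norm_triangle L2_space_diff) auto
    then show "\<exists>d\<in>D. L2_norm M (\<lambda>x. f x - d x) < \<epsilon>"
      using d v by (intro bexI[of _ d]) auto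
  qed
  ultimately show ?thesis
    using V subsetD[OF L2_closure_superset[OF D] zero] by (auto simp: L2_closed_subspace_def)
qed

lemma L2_denseI_closure:
  assumes "D \<subseteq> L2_space M" "L2_space M \<subseteq> L2_closure M D"
  shows "L2_dense M D"
  using assms by (auto simp: L2_dense_def L2_closure_def)

lemma L2_closed_subspaceD:
  assumes "L2_closed_subspace M V"
  shows "f \<in> V \<Longrightarrow> f \<in> L2_space M" "(\<lambda>x. 0) \<in> V"
    "f \<in> V \<Longrightarrow> g \<in> V \<Longrightarrow> (\<lambda>x. f x + g x) \<in> V"
    "f \<in> V \<Longrightarrow> (\<lambda>x. c * f x) \<in> V"
  using assms by (auto simp: L2_closed_subspace_def)

lemma L2_closed_subspace_diff:
  assumes "L2_closed_subspace M V" "f \<in> V" "g \<in> V"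
  shows "(\<lambda>x. f x - g x) \<in> V"
  using L2_closed_subspaceD(3)[OF assms(1,2) L2_closed_subspaceD(4)[OF assms(1,3), of "-1"]]
  by simp

lemma L2_closed_subspace_sum:
  assumes "L2_closed_subspace M V" "\<And>i. i \<in> A \<Longrightarrow> f i \<in> V"
  shows "(\<lambda>x. \<Sum>i\<in>A. f i x) \<in> V"
  using assms(2) by (induction A rule: infinite_finite_induct)
    (auto simp: L2_closed_subspaceD(2,3)[OF assms(1)])

lemma L2_closed_subspace_dominated_limit:
  assumes V: "L2_closed_subspace M V" and F: "\<And>n. F n \<in> V"
    and f: "f \<in> borel_measurable M"
    and lim: "AE x in M. (\<lambda>n. F n x) \<longlonglongrightarrow> f x"
    and w: "integrable M (\<lambda>x. (w x)\<^sup>2)"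
    and bound: "\<And>n. AE x in M. cmod (F n x) \<le> w x"
  shows "f \<in> V"
proof -
  have F_L2: "F n \<in> L2_space M" for n using L2_closed_subspaceD(1)[OF V F] .
  have bound': "AE x in M. \<forall>n. cmod (F n x) \<le> w x"
    using bound by (simp add: AE_all_countable)
  have f_bound: "AE x in M. cmod (f x) \<le> w x"
    using lim bound'
  proof eventually_elim
    case (elim x)
    then show ?case by (intro Lim_norm_ubound[OF _ elim(1)]) auto
  qed
  have f_L2: "f \<in> L2_space M"
    using f_bound by (intro L2_spaceI_bound[OF f w]) (auto elim!: eventually_mono intro: power_mono)
  have "(\<lambda>n. \<integral>x. (cmod (f x - F n x))\<^sup>2 \<partial>M) \<longlonglongrightarrow> (\<integral>x. 0 \<partial>M)"
  proof (rule integral_dominated_convergence)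
    show "integrable M (\<lambda>x. 4 * (w x)\<^sup>2)" using w by simp
    show "(\<lambda>x. (cmod (f x - F n x))\<^sup>2) \<in> borel_measurable M" for n
      using f L2_space_measurable[OF F_L2] by auto
    show "AE x in M. (\<lambda>n. (cmod (f x - F n x))\<^sup>2) \<longlonglongrightarrow> 0"
      using lim
    proof eventually_elim
      case (elim x)
      then have "(\<lambda>n. (cmod (f x - F n x))\<^sup>2) \<longlonglongrightarrow> (cmod (f x - f x))\<^sup>2"
        by (intro tendsto_intros)
      then show ?case by simp
    qed
    show "AE x in M. norm ((cmod (f x - F n x))\<^sup>2) \<le> 4 * (w x)\<^sup>2" for n
      using bound[of n] f_bound
    proof eventually_elim
      case (elim x)
      have "cmod (f x - F n x) \<le> 2 * w x" using elim norm_triangle_ineq4[of "f x" "F n x"] by linarith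
      then have "(cmod (f x - F n x))\<^sup>2 \<le> (2 * w x)\<^sup>2" by (intro power_mono) auto
      then show ?case by (simp add: power_mult_distrib)
    qed
  qed auto
  then have "(\<lambda>n. L2_norm M (\<lambda>x. f x - F n x)) \<longlonglongrightarrow> sqrt 0"
    unfolding L2_norm_def by (intro tendsto_real_sqrt) simp
  then have "\<forall>\<^sub>F n in sequentially. L2_norm M (\<lambda>x. f x - F n x) < \<epsilon>" if "\<epsilon> > 0" for \<epsilon>
    using that by (intro order_tendstoD(2)[of _ "sqrt 0"]) auto
  then have "\<exists>n. L2_norm M (\<lambda>x. f x - F n x) < \<epsilon>" if "\<epsilon> > 0" for \<epsilon>
    using that eventually_happens'[OF sequentially_bot] by blast
  then have "\<forall>\<epsilon>>0. \<exists>v\<in>V. L2_norm M (\<lambda>x. f x - v x) < \<epsilon>"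
    using F by blast
  then show ?thesis
    using V f_L2 by (simp add: L2_closed_subspace_def)
qed

lemma L2_closed_subspace_cong_AE:
  assumes V: "L2_closed_subspace M V" and "f \<in> V" "g \<in> borel_measurable M" "AE x in M. f x = g x"
  shows "g \<in> V"
proof (rule L2_closed_subspace_dominated_limit[OF V, of "\<lambda>_. f"])
  show "integrable M (\<lambda>x. (cmod (f x))\<^sup>2)"
    using L2_closed_subspaceD(1)[OF V \<open>f \<in> V\<close>] by (rule L2_space_integrable)
qed (use assms in auto)

text \<open>
  A measurable function is a pointwise limit of simple functions of at most twice its modulus.
  For a square-integrable function, their nonzero values are taken on sets of finite measure.
\<close>

lemma L2_closed_subspace_eq_L2_space:
  assumes V: "L2_closed_subspace M V"
    and ind: "\<And>A. A \<in> sets M \<Longrightarrow> emeasure M A < \<infinity> \<Longrightarrow> indicator A \<in> V"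
  shows "V = L2_space M"
proof
  show "V \<subseteq> L2_space M" using L2_closed_subspaceD(1)[OF V] by auto
  show "L2_space M \<subseteq> V"
  proof
    fix f :: "'a \<Rightarrow> complex" assume f: "f \<in> L2_space M"
    note f_meas = L2_space_measurable[OF f]
    obtain F where F: "\<And>i. simple_function M (F i)"
      "\<And>x. x \<in> space M \<Longrightarrow> (\<lambda>i. F i x) \<longlonglongrightarrow> f x"
      "\<And>i x. x \<in> space M \<Longrightarrow> cmod (F i x) \<le> 2 * cmod (f x)"
      using borel_measurable_implies_sequence_metric[OF f_meas, of 0]
      by (auto simp: dist_norm) blast
    have F_V: "F i \<in> V" for i
    proof -
      have fin: "finite (F i ` space M)" using F(1) by (auto simp: simple_function_def)
      have "(\<lambda>x. \<Sum>y\<in>F i ` space M. y * indicator (F i -` {y} \<inter> space M) x) \<in> V"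
      proof (rule L2_closed_subspace_sum[OF V])
        fix y assume "y \<in> F i ` space M"
        show "(\<lambda>x. y * indicator (F i -` {y} \<inter> space M) x) \<in> V"
        proof (cases "y = 0")
          case True
          then show ?thesis using L2_closed_subspaceD(2)[OF V] by simp
        next
          case False
          let ?A = "F i -` {y} \<inter> space M"
          have A: "?A \<in> sets M" using F(1)[of i] by (rule simple_functionD(2))
          \<comment> \<open>On \<open>?A\<close> the modulus of \<open>f\<close> is at least half that of \<open>y\<close>; Markov's inequality.\<close>
          have "emeasure M ?A = (\<integral>\<^sup>+x. indicator ?A x \<partial>M)" using A by simp
          also have "\<dots> \<le> (\<integral>\<^sup>+x. ennreal (4 / (cmod y)\<^sup>2) * ennreal ((cmod (f x))\<^sup>2) \<partial>M)"
          proof (rule nn_integral_mono)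
            fix x assume x: "x \<in> space M"
            show "indicator ?A x \<le> ennreal (4 / (cmod y)\<^sup>2) * ennreal ((cmod (f x))\<^sup>2)"
            proof (cases "F i x = y")
              case True
              then have "(cmod y)\<^sup>2 \<le> (2 * cmod (f x))\<^sup>2" using F(3)[OF x, of i] by (intro power_mono) auto
              then have "1 \<le> 4 / (cmod y)\<^sup>2 * (cmod (f x))\<^sup>2"
                using False by (simp add: field_simps power_mult_distrib)
              then show ?thesis using True x by (simp flip: ennreal_mult ennreal_1)
            qed simp
          qed
          also have "\<dots> < \<infinity>"
            using f f_meas by (simp add: nn_integral_cmult nn_integral_L2[OF f] ennreal_mult_less_top)
          finally have "indicator ?A \<in> V" using ind[OF A] by simp
          then show ?thesis by (rule L2_closed_subspaceD(4)[OF V])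
        qed
      qed
      then show ?thesis
      proof (rule L2_closed_subspace_cong_AE[OF V])
        show "F i \<in> borel_measurable M" using F(1) by (rule borel_measurable_simple_function)
        have "(\<Sum>y\<in>F i ` space M. y * indicator (F i -` {y} \<inter> space M) x) = F i x"
          if "x \<in> space M" for x
        proof -
          have "(\<Sum>y\<in>F i ` space M. y * indicator (F i -` {y} \<inter> space M) x) =
              (\<Sum>y\<in>F i ` space M. if y = F i x then y else 0)"
            using that by (intro sum.cong) (auto simp: indicator_def)
          then show ?thesis using fin that by simp
        qed
        then show "AE x in M. (\<Sum>y\<in>F i ` space M. y * indicator (F i -` {y} \<inter> space M) x) = F i x"
          by simp
      qed
    qed
    show "f \<in> V"
    proof (rule L2_closed_subspace_dominated_limit[OF V F_V f_meas, where w = "\<lambda>x. 2 * cmod (f x)"])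
      show "integrable M (\<lambda>x. (2 * cmod (f x))\<^sup>2)"
        using L2_space_integrable[OF f] by (simp add: power_mult_distrib)
      show "AE x in M. (\<lambda>i. F i x) \<longlonglongrightarrow> f x" using F(2) by simp
      show "AE x in M. cmod (F i x) \<le> 2 * cmod (f x)" for i using F(3) by simp
    qed
  qed
qed

lemma integrable_indicator_Icc_lebesgue_on:
  assumes "S \<in> sets lebesgue"
  shows "integrable (lebesgue_on S) (indicator {a..b::real} :: real \<Rightarrow> real)"
proof -
  have "emeasure lebesgue (S \<inter> {a..b}) \<le> emeasure lebesgue {a..b}"
    by (intro emeasure_mono) auto
  also have "\<dots> < \<infinity>" by (cases "a \<le> b") auto
  finally have "integrable lebesgue (indicator (S \<inter> {a..b}) :: real \<Rightarrow> real)"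
    using assms by (intro integrable_real_indicator) auto
  then show ?thesis
    using assms by (subst integrable_restrict_space) (auto simp flip: indicator_inter_arith)
qed

text \<open>
  Compact intervals are stable under intersection and generate the Borel sets. The sets whose
  indicators lie in the subspace form a Dynkin system once everything is intersected with a fixed
  compact interval, which keeps the measures finite. Lebesgue measurable sets differ from Borel
  sets by null sets.
\<close>

lemma L2_closed_subspace_lebesgue_on:
  fixes S :: "real set"
  assumes S: "S \<in> sets lebesgue" and V: "L2_closed_subspace (lebesgue_on S) V"
    and interval: "\<And>a b. indicator {a..b} \<in> V"
  shows "V = L2_space (lebesgue_on S)"
proof (rule L2_closed_subspace_eq_L2_space[OF V])
  let ?M = "lebesgue_on S"
  have borel_meas: "(indicator A :: real \<Rightarrow> complex) \<in> borel_measurable ?M" if "A \<in> sets lebesgue" for A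
    using that by (intro measurable_restrict_space1) auto
  have borel: "indicator (A \<inter> {c..d}) \<in> V" if A: "A \<in> sets borel" for A and c d :: real
  proof -
    let ?G = "range (\<lambda>(a::real, b). {a..b})"
    have "Int_stable ?G"
    proof (rule Int_stableI)
      fix X Y :: "real set" assume "X \<in> ?G" "Y \<in> ?G"
      then obtain a b a' b' where "X = {a..b}" "Y = {a'..b'}" by auto
      then have "X \<inter> Y = (\<lambda>(a, b). {a..b}) (max a a', min b b')" by auto
      then show "X \<inter> Y \<in> ?G" by blast
    qed
    moreover have "?G \<subseteq> Pow UNIV" by simp
    moreover have "A \<in> sigma_sets UNIV ?G"
      using A by (subst (asm) borel_eq_atLeastAtMost) (simp add: sets_measure_of)
    ultimately show ?thesis
    proof (induction rule: sigma_sets_induct_disjoint)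
      case (basic A)
      then show ?case using interval by auto
    next
      case empty
      have "(indicator ({} \<inter> {c..d}) :: real \<Rightarrow> complex) = (\<lambda>x. 0)" by auto
      then show ?case using L2_closed_subspaceD(2)[OF V] by (simp only:)
    next
      case (compl A)
      have "(\<lambda>x. indicator {c..d} x - indicator (A \<inter> {c..d}) x :: complex) \<in> V"
        by (intro L2_closed_subspace_diff[OF V] interval compl)
      also have "(\<lambda>x. indicator {c..d} x - indicator (A \<inter> {c..d}) x :: complex) =
          indicator ((UNIV - A) \<inter> {c..d})"
        by (auto simp: indicator_def fun_eq_iff)
      finally show ?case .
    next
      case (union A)
      have A_borel: "A i \<in> sets borel" for i
        using union.hyps(2) by (subst borel_eq_atLeastAtMost) (auto simp: sets_measure_of)
      show ?case
      proof (rule L2_closed_subspace_dominated_limit[OF V,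
            where F = "\<lambda>n x. \<Sum>i<n. indicator (A i \<inter> {c..d}) x" and w = "indicator {c..d}"])
        show "(\<lambda>x. \<Sum>i<n. indicator (A i \<inter> {c..d}) x :: complex) \<in> V" for n
          by (intro L2_closed_subspace_sum[OF V] union.IH)
        have sum_eq: "(\<Sum>i<n. indicator (A i \<inter> {c..d}) x :: complex) =
            indicator (\<Union>i<n. A i \<inter> {c..d}) x" for n x
          using union.hyps(1)
          by (intro indicator_UN_disjoint[symmetric]) (auto simp: disjoint_family_on_def)
        show "(indicator (\<Union> (range A) \<inter> {c..d}) :: real \<Rightarrow> complex) \<in> borel_measurable ?M"
          using A_borel by (intro borel_meas) auto
        have "(\<lambda>n. indicator (\<Union>i<n. A i \<inter> {c..d}) x :: complex) \<longlonglongrightarrow>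
            indicator (\<Union>i. A i \<inter> {c..d}) x" for x
          by (rule LIMSEQ_indicator_UN)
        then show "AE x in ?M. (\<lambda>n. \<Sum>i<n. indicator (A i \<inter> {c..d}) x :: complex) \<longlonglongrightarrow>
            indicator (\<Union> (range A) \<inter> {c..d}) x"
          unfolding sum_eq by (simp add: Int_commute)
        have "(\<lambda>x. (indicator {c..d} x :: real)\<^sup>2) = indicator {c..d}"
          by (auto simp: indicator_def fun_eq_iff)
        then show "integrable ?M (\<lambda>x. (indicator {c..d} x :: real)\<^sup>2)"
          using integrable_indicator_Icc_lebesgue_on[OF S] by simp
        show "AE x in ?M. cmod (\<Sum>i<n. indicator (A i \<inter> {c..d}) x) \<le> indicator {c..d} x" for n
          unfolding sum_eq by (auto simp: indicator_def)
      qed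
    qed
  qed
  fix A assume A: "A \<in> sets ?M" and fin: "emeasure ?M A < \<infinity>"
  have A_leb: "A \<in> sets lebesgue" using A S by (simp add: sets_restrict_space_iff)
  then obtain B N N' where BN: "A = B \<union> N" "N \<subseteq> N'" "N' \<in> null_sets lborel" "B \<in> sets borel"
    by (auto elim!: sets_completionE)
  have "AE x in lebesgue. x \<notin> N'"
    using BN(3) by (intro AE_not_in null_sets_completionI)
  then have AE_N: "AE x in ?M. x \<notin> N'"
    using S by (subst AE_restrict_space_iff) auto
  show "indicator A \<in> V"
  proof (rule L2_closed_subspace_dominated_limit[OF V,
        where F = "\<lambda>n. indicator (B \<inter> {- real n..real n})" and w = "indicator A"])
    show "indicator (B \<inter> {- real n..real n}) \<in> V" for n by (rule borel[OF BN(4)])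
    show "(indicator A :: real \<Rightarrow> complex) \<in> borel_measurable ?M" by (rule borel_meas[OF A_leb])
    show "AE x in ?M. (\<lambda>n. indicator (B \<inter> {- real n..real n}) x :: complex) \<longlonglongrightarrow> indicator A x"
      using AE_N
    proof eventually_elim
      case (elim x)
      obtain n0 where n0: "\<bar>x\<bar> \<le> real n0" using real_arch_simple by blast
      have "indicator (B \<inter> {- real n..real n}) x = (indicator A x :: complex)" if "n0 \<le> n" for n
        using that n0 elim BN by (auto simp: indicator_def)
      then show ?case
        by (intro tendsto_eventually) (auto simp: eventually_sequentially)
    qed
    have "(\<lambda>x. (indicator A x :: real)\<^sup>2) = indicator A"
      by (auto simp: indicator_def fun_eq_iff)
    then show "integrable ?M (\<lambda>x. (indicator A x :: real)\<^sup>2)"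
      using integrable_real_indicator[OF A] fin by simp
    have "cmod (indicator (B \<inter> {- real n..real n}) x) \<le> indicator A x" for n x
      using BN(1) by (simp add: indicator_def)
    then show "AE x in ?M. cmod (indicator (B \<inter> {- real n..real n}) x) \<le> indicator A x" for n
      by simp
  qed
qed

section \<open>Completeness of the trigonometric system\<close>

definition fourier_char :: "int \<Rightarrow> real \<Rightarrow> complex" where
  "fourier_char m s = exp (2 * pi * \<i> * s * of_int m)"

lemma fourier_char_cis: "fourier_char m s = cis (2 * pi * s * of_int m)"
  by (simp add: fourier_char_def cis_conv_exp algebra_simps)

lemma fourier_char_0 [simp]: "fourier_char 0 s = 1"
  by (simp add: fourier_char_def)

lemma fourier_char_mult: "fourier_char m s * fourier_char n s = fourier_char (m + n) s"
  by (simp add: fourier_char_cis cis_mult algebra_simps)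

lemma cnj_fourier_char: "cnj (fourier_char m s) = fourier_char (- m) s"
  by (simp add: fourier_char_cis cis_cnj)

lemma norm_fourier_char [simp]: "cmod (fourier_char m s) = 1"
  by (simp add: fourier_char_cis)

lemma fourier_char_add_int: "fourier_char m (s + of_int k) = fourier_char m s"
proof -
  have "fourier_char m (s + of_int k) = cis (2 * pi * s * of_int m) * cis (2 * pi * of_int (k * m))"
    by (simp add: fourier_char_cis cis_mult algebra_simps)
  then show ?thesis by (simp add: fourier_char_cis cis_multiple_2pi)
qed

lemma continuous_on_fourier_char: "continuous_on A (fourier_char m)"
  unfolding fourier_char_def by (intro continuous_intros)

lemma borel_measurable_fourier_char [measurable]: "fourier_char m \<in> borel_measurable borel"
  by (intro borel_measurable_continuous_onI continuous_on_fourier_char)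

lemma borel_measurable_lebesgue_on:
  assumes "f \<in> borel_measurable borel"
  shows "f \<in> borel_measurable (lebesgue_on S)"
  using assms by (intro measurable_restrict_space1 measurable_completion) simp

lemma integral_fourier_char:
  "(\<integral>t. fourier_char m t \<partial>lebesgue_on {0..1}) = (if m = 0 then 1 else 0)"
proof -
  have "(\<integral>t. fourier_char m t \<partial>lebesgue_on {0..1}) = (\<integral>t. indicator {0..1} t *\<^sub>R fourier_char m t \<partial>lborel)"
    by (subst integral_restrict_space) (auto simp: integral_completion)
  also have "\<dots> = (if m = 0 then 1 else 0)"
  proof (cases "m = 0")
    case False
    define F where "F t = fourier_char m t / (2 * pi * \<i> * of_int m)" for t
    \<comment> \<open>The primitive is again 1-periodic.\<close>
    have "(\<integral>t. indicator {0..1} t *\<^sub>R fourier_char m t \<partial>lborel) = F 1 - F 0"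
    proof (rule integral_FTC_Icc)
      fix t :: real assume "0 \<le> t" "t \<le> 1"
      show "(F has_vector_derivative fourier_char m t) (at t within {0..1})"
        unfolding F_def fourier_char_def
        by (rule has_vector_derivative_real_field[where
              f = "\<lambda>z. exp (2 * pi * \<i> * z * of_int m) / (2 * pi * \<i> * of_int m)"])
          (use False in \<open>auto intro!: derivative_eq_intros\<close>)
    qed (auto intro: continuous_on_fourier_char)
    also have "F 1 = F 0"
      using fourier_char_add_int[of m 0 1] by (simp add: F_def)
    finally show ?thesis using False by simp
  qed simp
  finally show ?thesis .
qed

definition trig_polys :: "(real \<Rightarrow> complex) set" where
  "trig_polys = {\<lambda>t. \<Sum>m\<in>S. c m * fourier_char m t | S c. finite S}"

lemma trig_polys_char: "(\<lambda>t. c * fourier_char m t) \<in> trig_polys"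
  unfolding trig_polys_def by (intro CollectI exI[of _ "{m}"] exI[of _ "\<lambda>_. c"]) auto

lemma trig_polys_const: "(\<lambda>t. c) \<in> trig_polys"
  using trig_polys_char[of c 0] by simp

lemma trig_polys_add:
  assumes "p \<in> trig_polys" "q \<in> trig_polys"
  shows "(\<lambda>t. p t + q t) \<in> trig_polys"
proof -
  obtain S c T d where S: "finite S" "p = (\<lambda>t. \<Sum>m\<in>S. c m * fourier_char m t)"
    and T: "finite T" "q = (\<lambda>t. \<Sum>m\<in>T. d m * fourier_char m t)"
    using assms unfolding trig_polys_def by auto
  let ?c = "\<lambda>m. (if m \<in> S then c m else 0) + (if m \<in> T then d m else 0)"
  have "p t + q t = (\<Sum>m\<in>S \<union> T. ?c m * fourier_char m t)" for t
  proof -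
    have "p t = (\<Sum>m\<in>S \<union> T. (if m \<in> S then c m else 0) * fourier_char m t)"
      unfolding S(2) using S T by (intro sum.mono_neutral_cong_left) auto
    moreover have "q t = (\<Sum>m\<in>S \<union> T. (if m \<in> T then d m else 0) * fourier_char m t)"
      unfolding T(2) using S T by (intro sum.mono_neutral_cong_left) auto
    ultimately show ?thesis by (simp add: distrib_right sum.distrib)
  qed
  then show ?thesis
    unfolding trig_polys_def using S T by (intro CollectI exI[of _ "S \<union> T"] exI[of _ ?c]) auto
qed

lemma trig_polys_sum:
  assumes "\<And>i. i \<in> A \<Longrightarrow> f i \<in> trig_polys"
  shows "(\<lambda>t. \<Sum>i\<in>A. f i t) \<in> trig_polys"
  using assms by (induction A rule: infinite_finite_induct)
    (auto intro: trig_polys_add trig_polys_const)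

lemma trig_polys_mult:
  assumes "p \<in> trig_polys" "q \<in> trig_polys"
  shows "(\<lambda>t. p t * q t) \<in> trig_polys"
proof -
  obtain S c T d where S: "finite S" "p = (\<lambda>t. \<Sum>m\<in>S. c m * fourier_char m t)"
    and T: "finite T" "q = (\<lambda>t. \<Sum>m\<in>T. d m * fourier_char m t)"
    using assms unfolding trig_polys_def by auto
  have "(\<lambda>t. p t * q t) = (\<lambda>t. \<Sum>m\<in>S. \<Sum>n\<in>T. (c m * d n) * fourier_char (m + n) t)"
    unfolding S(2) T(2) by (auto simp: sum_product fourier_char_mult[symmetric] mult_ac)
  then show ?thesis by (auto intro!: trig_polys_sum trig_polys_char)
qed

lemma trig_polys_scale: "p \<in> trig_polys \<Longrightarrow> (\<lambda>t. c * p t) \<in> trig_polys"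
  by (intro trig_polys_mult trig_polys_const)

text \<open>
  Real and imaginary part of \<open>z\<close> on the unit circle are combinations of \<open>z\<close> and its conjugate,
  that is, of the characters of index 1 and -1. This is what lets Stone-Weierstrass, stated for
  polynomials on the plane, produce trigonometric polynomials.
\<close>

lemma trig_polys_real_polynomial:
  "real_polynomial_function P \<Longrightarrow> (\<lambda>t. complex_of_real (P (fourier_char 1 t))) \<in> trig_polys"
proof (induction P rule: real_polynomial_function.induct)
  case (linear h)
  then interpret h: bounded_linear h .
  define a where "a = complex_of_real (h 1)"
  define b where "b = complex_of_real (h \<i>)"
  have "complex_of_real (h (fourier_char 1 t)) =
      ((a - \<i> * b) / 2) * fourier_char 1 t + ((a + \<i> * b) / 2) * fourier_char (- 1) t" for t
  proof -
    let ?z = "fourier_char 1 t"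
    have "h ?z = h (Re ?z *\<^sub>R 1 + Im ?z *\<^sub>R \<i>)"
      by (rule arg_cong[of _ _ h]) (simp add: complex_eq_iff)
    also have "\<dots> = Re ?z * h 1 + Im ?z * h \<i>"
      by (simp add: h.add h.scaleR)
    finally have "complex_of_real (h ?z) = Re ?z * a + Im ?z * b" by (simp add: a_def b_def)
    also have "\<dots> = ((a - \<i> * b) / 2) * ?z + ((a + \<i> * b) / 2) * cnj ?z"
      by (simp add: complex_eq_iff a_def b_def field_simps)
    finally show ?thesis by (simp add: cnj_fourier_char)
  qed
  then show ?case by (simp only: trig_polys_add trig_polys_char)
next
  case (const c)
  then show ?case by (rule trig_polys_const)
next
  case (add f g)
  then show ?case using trig_polys_add by simp
next
  case (mult f g)
  then show ?case using trig_polys_mult by simp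
qed

lemma L2_space_lebesgue_on_bounded:
  assumes S: "S \<in> sets lebesgue" "emeasure lebesgue S < \<infinity>"
    and f: "f \<in> borel_measurable (lebesgue_on S)" and le: "\<And>x. x \<in> S \<Longrightarrow> cmod (f x) \<le> B"
  shows "f \<in> L2_space (lebesgue_on S)"
proof (rule L2_spaceI_bound[OF f])
  interpret finite_measure "lebesgue_on S"
    using S by (intro finite_measureI) (auto simp: emeasure_restrict_space)
  show "integrable (lebesgue_on S) (\<lambda>x. B\<^sup>2)" by simp
  show "AE x in lebesgue_on S. (cmod (f x))\<^sup>2 \<le> B\<^sup>2"
    using le S by (auto intro!: AE_I2 power_mono)
qed

lemma L2_norm_unit_interval_bound:
  assumes f: "f \<in> L2_space (lebesgue_on {0..1::real})" and le: "\<And>x. x \<in> {0..1} \<Longrightarrow> cmod (f x) \<le> B" 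
  shows "L2_norm (lebesgue_on {0..1}) f \<le> B"
proof -
  interpret finite_measure "lebesgue_on {0..1::real}"
    by (intro finite_measureI) (auto simp: emeasure_restrict_space)
  have B: "0 \<le> B" using order_trans[OF norm_ge_zero le[of 0]] by simp
  have "(L2_norm (lebesgue_on {0..1}) f)\<^sup>2 \<le> (\<integral>x. B\<^sup>2 \<partial>lebesgue_on {0..1::real})"
    unfolding L2_norm_squared
    by (intro integral_mono L2_space_integrable f) (auto intro!: power_mono le)
  also have "\<dots> = B\<^sup>2" by (simp add: measure_restrict_space)
  finally show ?thesis using B by (rule power2_le_imp_le)
qed

lemma trig_polys_borel: "p \<in> trig_polys \<Longrightarrow> p \<in> borel_measurable borel"
  unfolding trig_polys_def by auto

lemma trig_polys_L2: "trig_polys \<subseteq> L2_space (lebesgue_on {0..1})"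
proof
  fix p assume p: "p \<in> trig_polys"
  then obtain S c where S: "finite S" "p = (\<lambda>t. \<Sum>m\<in>S. c m * fourier_char m t)"
    unfolding trig_polys_def by auto
  have "cmod (p t) \<le> (\<Sum>m\<in>S. cmod (c m))" for t
    unfolding S(2) by (rule order_trans[OF norm_sum]) (simp add: norm_mult)
  then show "p \<in> L2_space (lebesgue_on {0..1})"
    using borel_measurable_lebesgue_on[OF trig_polys_borel[OF p]]
    by (intro L2_space_lebesgue_on_bounded) auto
qed

lemma L2_closed_subspace_closure_trig_polys:
  "L2_closed_subspace (lebesgue_on {0..1}) (L2_closure (lebesgue_on {0..1}) trig_polys)"
  by (rule L2_closed_subspace_closure[where Q = UNIV])
    (auto intro: trig_polys_L2[THEN subsetD] trig_polys_const trig_polys_add trig_polys_scale)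

lemma continuous_on_circle_closure_trig_polys:
  fixes \<Phi> :: "complex \<Rightarrow> real"
  assumes \<Phi>: "continuous_on (sphere 0 1) \<Phi>"
  shows "(\<lambda>t. complex_of_real (\<Phi> (fourier_char 1 t))) \<in> L2_closure (lebesgue_on {0..1}) trig_polys"
  unfolding L2_closure_def
proof (intro CollectI conjI allI impI)
  let ?f = "\<lambda>t. complex_of_real (\<Phi> (fourier_char 1 t))"
  have circle: "fourier_char 1 t \<in> sphere 0 1" for t by simp
  have cont: "continuous_on UNIV ?f"
    using circle by (intro continuous_on_of_real continuous_on_compose2[OF \<Phi> continuous_on_fourier_char]) auto
  have meas: "?f \<in> borel_measurable (lebesgue_on {0..1})"
    by (intro borel_measurable_lebesgue_on borel_measurable_continuous_onI cont)
  have "bounded (\<Phi> ` sphere 0 1)"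
    by (intro compact_imp_bounded compact_continuous_image \<Phi>) auto
  then obtain B where "\<forall>y\<in>\<Phi> ` sphere 0 1. norm y \<le> B"
    unfolding bounded_iff by blast
  then have "cmod (?f t) \<le> B" for t using circle by simp
  then show f: "?f \<in> L2_space (lebesgue_on {0..1})"
    using meas by (intro L2_space_lebesgue_on_bounded) auto
  fix \<epsilon> :: real assume \<epsilon>: "\<epsilon> > 0"
  obtain P where P: "real_polynomial_function P" "\<And>z. z \<in> sphere 0 1 \<Longrightarrow> \<bar>\<Phi> z - P z\<bar> < \<epsilon> / 2"
    using Stone_Weierstrass_real_polynomial_function[OF compact_sphere \<Phi>, of "\<epsilon> / 2"] \<epsilon> by auto
  let ?p = "\<lambda>t. complex_of_real (P (fourier_char 1 t))"
  have p: "?p \<in> trig_polys" by (rule trig_polys_real_polynomial[OF P(1)])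
  have "L2_norm (lebesgue_on {0..1}) (\<lambda>t. ?f t - ?p t) \<le> \<epsilon> / 2"
  proof (rule L2_norm_unit_interval_bound)
    show "(\<lambda>t. ?f t - ?p t) \<in> L2_space (lebesgue_on {0..1})"
      using f p trig_polys_L2 by (intro L2_space_diff) auto
    have "cmod (?f t - ?p t) = \<bar>\<Phi> (fourier_char 1 t) - P (fourier_char 1 t)\<bar>" for t
      by (metis norm_of_real of_real_diff)
    then show "cmod (?f t - ?p t) \<le> \<epsilon> / 2" for t
      using P(2)[OF circle] by (simp add: less_imp_le)
  qed
  then show "\<exists>p\<in>trig_polys. L2_norm (lebesgue_on {0..1}) (\<lambda>t. ?f t - p t) < \<epsilon>"
    using p \<epsilon> by (intro bexI[of _ ?p]) auto
qed

text \<open>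
  The projection of the circle to the axis through the midpoint of an arc is larger on the arc than
  off it, so the arc is cut out by one linear inequality. The end points of the unit interval
  are excluded because they are the same point of the circle.
\<close>

lemma cos_ge_iff_in_interval:
  assumes ab: "0 \<le> a" "a \<le> b" "b \<le> 1" and t: "0 < t" "t < 1"
  shows "cos (pi * (b - a)) \<le> cos (2 * pi * (t - (a + b) / 2)) \<longleftrightarrow> t \<in> {a..b}"
proof -
  define d where "d = \<bar>t - (a + b) / 2\<bar>"
  define r where "r = (b - a) / 2"
  have cd: "cos (2 * pi * (t - (a + b) / 2)) = cos (2 * pi * d)"
  proof -
    have "2 * pi * d = \<bar>2 * pi * (t - (a + b) / 2)\<bar>" by (simp only: d_def abs_mult) simp
    then show ?thesis by (simp only: cos_abs_real)
  qed
  have cr: "pi * (b - a) = 2 * pi * r" by (simp add: r_def)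
  have r: "0 \<le> r" "r \<le> 1 / 2" using ab by (auto simp: r_def)
  \<comment> \<open>Strictness excludes reaching the interval the other way round the circle.\<close>
  have d: "0 \<le> d" "d + r < 1" using ab t by (auto simp: d_def r_def abs_if field_simps)
  have mem: "t \<in> {a..b} \<longleftrightarrow> d \<le> r" by (auto simp: d_def r_def abs_if field_simps)
  have strict: "cos (2 * pi * u) < cos (2 * pi * r)" if "r < u" "u \<le> 1 / 2" for u
    using that r by (intro cos_monotone_0_pi) auto
  have "cos (2 * pi * r) \<le> cos (2 * pi * d) \<longleftrightarrow> d \<le> r"
  proof
    assume "d \<le> r"
    then show "cos (2 * pi * r) \<le> cos (2 * pi * d)"
      using d r by (intro cos_monotone_0_pi_le) auto
  next
    assume le: "cos (2 * pi * r) \<le> cos (2 * pi * d)"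
    show "d \<le> r"
    proof (rule ccontr)
      assume "\<not> d \<le> r"
      show False
      proof (cases "d \<le> 1 / 2")
        case True
        then show False using strict[of d] \<open>\<not> d \<le> r\<close> le by auto
      next
        case False
        have "cos (2 * pi * (1 - d)) = cos (2 * pi * d)"
          by (simp add: right_diff_distrib cos_diff)
        then show False using strict[of "1 - d"] False d le by auto
      qed
    qed
  qed
  then show ?thesis by (simp only: cd cr mem)
qed

text \<open>
  The arc is a superlevel set of a linear function on the plane, so its indicator is a decreasing
  limit of continuous functions of that linear function. They are continuous on the circle, hence
  no periodic continuous function on the line has to be constructed.
\<close>

lemma interval_in_closure_trig_polys:
  "indicator {a..b} \<in> L2_closure (lebesgue_on {0..1}) trig_polys"
proof -
  let ?M = "lebesgue_on {0..1::real}"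
  let ?V = "L2_closure ?M trig_polys"
  note V = L2_closed_subspace_closure_trig_polys
  have ind_meas: "(indicator {a..b} :: real \<Rightarrow> complex) \<in> borel_measurable ?M"
    by (intro borel_measurable_lebesgue_on) auto
  show ?thesis
  proof (cases "max a 0 \<le> min b 1")
    case False
    have "AE t in ?M. 0 = (indicator {a..b} t :: complex)"
      using False by (intro AE_I2) (auto simp: indicator_def)
    then show ?thesis
      by (rule L2_closed_subspace_cong_AE[OF V L2_closed_subspaceD(2)[OF V] ind_meas])
  next
    case True
    define a' b' where "a' = max a 0" and "b' = min b 1"
    have ab: "0 \<le> a'" "a' \<le> b'" "b' \<le> 1" using True by (auto simp: a'_def b'_def)
    \<comment> \<open>\<open>w\<close> is the midpoint of the arc and \<open>\<kappa>\<close> the level; \<open>\<Phi> n\<close> falls linearly with slope \<open>n\<close>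
      from 1 to 0 below that level.\<close>
    define w where "w = fourier_char 1 ((a' + b') / 2)"
    define \<kappa> where "\<kappa> = cos (pi * (b' - a'))"
    define \<Phi> where "\<Phi> n z = max 0 (1 - real n * max 0 (\<kappa> - Re (z * cnj w)))" for n z
    have Re_eq: "Re (fourier_char 1 t * cnj w) = cos (2 * pi * (t - (a' + b') / 2))" for t
      by (simp add: w_def fourier_char_cis cis_cnj cis_mult algebra_simps)
    show ?thesis
    proof (rule L2_closed_subspace_dominated_limit[OF V _ ind_meas,
          where F = "\<lambda>n t. complex_of_real (\<Phi> n (fourier_char 1 t))" and w = "\<lambda>_. 1"])
      show "(\<lambda>t. complex_of_real (\<Phi> n (fourier_char 1 t))) \<in> ?V" for n
        unfolding \<Phi>_def by (intro continuous_on_circle_closure_trig_polys continuous_intros)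
      have "AE t in lborel. t \<noteq> 0 \<and> t \<noteq> (1::real)"
        by (intro AE_conjI AE_lborel_singleton)
      then have "AE t in lebesgue. t \<noteq> 0 \<and> t \<noteq> (1::real)" by (rule AE_completion)
      then have "AE t in ?M. t \<noteq> 0 \<and> t \<noteq> 1"
        by (subst AE_restrict_space_iff) auto
      then show "AE t in ?M. (\<lambda>n. complex_of_real (\<Phi> n (fourier_char 1 t))) \<longlonglongrightarrow> indicator {a..b} t"
        using AE_space
      proof eventually_elim
        case (elim t)
        then have t: "0 < t" "t < 1" by auto
        define u where "u = Re (fourier_char 1 t * cnj w)"
        have iff: "\<kappa> \<le> u \<longleftrightarrow> t \<in> {a..b}"
          using cos_ge_iff_in_interval[OF ab t] t unfolding u_def Re_eq \<kappa>_def by (auto simp: a'_def b'_def)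
        have \<Phi>_u: "\<Phi> n (fourier_char 1 t) = max 0 (1 - real n * max 0 (\<kappa> - u))" for n
          by (simp only: \<Phi>_def u_def)
        have "(\<lambda>n. \<Phi> n (fourier_char 1 t)) \<longlonglongrightarrow> indicator {a..b} t"
        proof (cases "\<kappa> \<le> u")
          case True
          then show ?thesis using iff by (simp add: \<Phi>_u)
        next
          case False
          obtain n0 where n0: "1 / (\<kappa> - u) < real n0" using reals_Archimedean2 by blast
          have "\<Phi> n (fourier_char 1 t) = 0" if "n0 \<le> n" for n
          proof -
            have "1 / (\<kappa> - u) < real n" using n0 that by linarith
            then have "1 < real n * (\<kappa> - u)" using False by (simp add: field_simps)
            then show ?thesis using False by (simp add: \<Phi>_u)
          qed
          then have "(\<lambda>n. \<Phi> n (fourier_char 1 t)) \<longlonglongrightarrow> 0"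
            by (intro tendsto_eventually) (auto simp: eventually_sequentially)
          then show ?thesis using iff False by simp
        qed
        then have "(\<lambda>n. complex_of_real (\<Phi> n (fourier_char 1 t))) \<longlonglongrightarrow> complex_of_real (indicator {a..b} t)"
          by (rule tendsto_of_real)
        then show ?case by (cases "t \<in> {a..b}") simp_all
      qed
      show "integrable ?M (\<lambda>t. (1::real)\<^sup>2)"
        by (intro finite_measure.integrable_const finite_measureI) (auto simp: emeasure_restrict_space)
      show "AE t in ?M. cmod (complex_of_real (\<Phi> n (fourier_char 1 t))) \<le> 1" for n
        by (intro AE_I2) (simp add: \<Phi>_def)
    qed
  qed
qed

lemma trig_polys_dense: "L2_dense (lebesgue_on {0..1}) trig_polys"
proof (rule L2_denseI_closure[OF trig_polys_L2])
  show "L2_space (lebesgue_on {0..1}) \<subseteq> L2_closure (lebesgue_on {0..1}) trig_polys"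
    using L2_closed_subspace_lebesgue_on[OF _ L2_closed_subspace_closure_trig_polys interval_in_closure_trig_polys] by simp
qed

theorem parseval_frame_fourier_char:
  "parseval_frame (lebesgue_on {0..1}) UNIV fourier_char"
proof (rule parseval_frame_if_dense[OF _ trig_polys_dense])
  let ?M = "lebesgue_on {0..1::real}"
  show char_L2: "fourier_char m \<in> L2_space ?M" for m
    using trig_polys_L2 trig_polys_char[of 1 m] by auto
  fix p assume "p \<in> trig_polys"
  then obtain S c where S: "finite S" "p = (\<lambda>t. \<Sum>m\<in>S. c m * fourier_char m t)"
    unfolding trig_polys_def by auto
  have p_L2: "p \<in> L2_space ?M" using \<open>p \<in> trig_polys\<close> trig_polys_L2 by auto
  have char_int: "integrable ?M (fourier_char m)" for m
    using integrable_L2_product[OF char_L2[of m] char_L2[of 0]] by simp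
  have coeff: "L2_inner ?M p (fourier_char n) = (if n \<in> S then c n else 0)" for n
  proof -
    have "L2_inner ?M p (fourier_char n) = (\<integral>t. (\<Sum>m\<in>S. c m * fourier_char (m - n) t) \<partial>?M)"
      unfolding L2_inner_def S(2)
      by (simp add: sum_distrib_right cnj_fourier_char mult.assoc fourier_char_mult)
    also have "\<dots> = (\<Sum>m\<in>S. c m * (if m - n = 0 then 1 else 0))"
      using char_int by (simp only: integral_fourier_char Bochner_Integration.integral_sum
        integrable_mult_right integral_mult_right_zero)
    also have "\<dots> = (\<Sum>m\<in>S. if m = n then c m else 0)" by (intro sum.cong) auto
    finally show ?thesis using S(1) by simp
  qed
  have "complex_of_real ((L2_norm ?M p)\<^sup>2) = (\<integral>t. p t * cnj (p t) \<partial>?M)"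
    by (simp only: L2_norm_squared complex_norm_square flip: integral_complex_of_real)
  also have "\<dots> = (\<integral>t. (\<Sum>m\<in>S. cnj (c m) * (p t * cnj (fourier_char m t))) \<partial>?M)"
    by (subst (2) S(2)) (simp add: sum_distrib_left mult_ac)
  also have "\<dots> = (\<Sum>m\<in>S. cnj (c m) * L2_inner ?M p (fourier_char m))"
    using integrable_L2_product[OF p_L2 char_L2] by (simp add: L2_inner_def)
  also have "\<dots> = (\<Sum>m\<in>S. complex_of_real ((cmod (c m))\<^sup>2))"
    by (intro sum.cong) (auto simp: coeff mult.commute simp del: of_real_power simp flip: complex_norm_square)
  finally have norm_p: "(L2_norm ?M p)\<^sup>2 = (\<Sum>m\<in>S. (cmod (c m))\<^sup>2)"
    by (simp only: of_real_sum[symmetric] of_real_eq_iff)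
  have "((\<lambda>m. (cmod (L2_inner ?M p (fourier_char m)))\<^sup>2) has_sum (\<Sum>m\<in>S. (cmod (c m))\<^sup>2)) UNIV"
    by (rule has_sum_finite_neutralI[OF S(1)]) (auto simp: coeff)
  then show "((\<lambda>m. (cmod (L2_inner ?M p (fourier_char m)))\<^sup>2) has_sum (L2_norm ?M p)\<^sup>2) UNIV"
    by (simp only: norm_p)
qed

section \<open>Characters on sets translation congruent to subsets of the unit interval\<close>

lemma parseval_frame_cong:
  assumes "\<And>j x. j \<in> J \<Longrightarrow> x \<in> space M \<Longrightarrow> \<psi> j x = \<phi> j x"
  shows "parseval_frame M J \<psi> \<longleftrightarrow> parseval_frame M J \<phi>"
proof -
  have "\<psi> j \<in> L2_space M \<longleftrightarrow> \<phi> j \<in> L2_space M" if "j \<in> J" for j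
    using assms[OF that] unfolding L2_space_def
    by (auto cong: measurable_cong Bochner_Integration.integrable_cong)
  moreover have "L2_inner M f (\<psi> j) = L2_inner M f (\<phi> j)" if "j \<in> J" for f j
    unfolding L2_inner_def using assms[OF that] by (intro Bochner_Integration.integral_cong) auto
  ultimately show ?thesis
    by (simp add: parseval_frame_def cong: has_sum_cong)
qed

lemma parseval_frame_pullback:
  fixes M :: "'a measure" and N :: "'b measure"
  assumes frame: "parseval_frame N J e" and \<tau>: "\<tau> \<in> measurable M N" and N: "distr M N \<tau> = N"
    and \<sigma>: "\<sigma> \<in> measurable N M" "\<And>x. x \<in> space M \<Longrightarrow> \<sigma> (\<tau> x) = x"
  shows "parseval_frame M J (\<lambda>j x. e j (\<tau> x))"
proof -
  have int_iff: "integrable M (\<lambda>x. h (\<tau> x)) \<longleftrightarrow> integrable N h" if "h \<in> borel_measurable N"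
    for h :: "'b \<Rightarrow> real"
    using integrable_distr_eq[OF \<tau>, of h] that N by simp
  have int_eq: "(\<integral>x. h (\<tau> x) \<partial>M) = (\<integral>y. h y \<partial>N)" if "h \<in> borel_measurable N"
    for h :: "'b \<Rightarrow> 'd::{banach, second_countable_topology}"
    using integral_distr[OF \<tau>, of h] that N by simp
  have int_eq_on: "(\<integral>x. u x \<partial>M) = (\<integral>y. h y \<partial>N)"
    if "h \<in> borel_measurable N" "\<And>x. x \<in> space M \<Longrightarrow> u x = h (\<tau> x)"
    for u :: "'a \<Rightarrow> 'f::{banach, second_countable_topology}" and h
    using int_eq[OF that(1)] that(2) by (metis (mono_tags, lifting) Bochner_Integration.integral_cong)
  have e: "e j \<in> L2_space N" if "j \<in> J" for j using frame that by (auto simp: parseval_frame_def)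
  have "(\<lambda>x. e j (\<tau> x)) \<in> L2_space M" if "j \<in> J" for j
    using e[OF that] int_iff[of "\<lambda>y. (cmod (e j y))\<^sup>2"] \<tau> by (auto simp: L2_space_def)
  moreover have "((\<lambda>j. (cmod (L2_inner M f (\<lambda>x. e j (\<tau> x))))\<^sup>2) has_sum (L2_norm M f)\<^sup>2) J"
    if f: "f \<in> L2_space M" for f
  proof -
    define h where "h y = f (\<sigma> y)" for y
    have f_h: "f x = h (\<tau> x)" if "x \<in> space M" for x using \<sigma>(2)[OF that] by (simp add: h_def)
    have h_meas: "h \<in> borel_measurable N"
      unfolding h_def using \<sigma>(1) L2_space_measurable[OF f] by measurable
    have "integrable M (\<lambda>x. (cmod (h (\<tau> x)))\<^sup>2)"
      using L2_space_integrable[OF f] f_h by (metis (mono_tags, lifting) Bochner_Integration.integrable_cong)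
    then have h: "h \<in> L2_space N"
      using int_iff[of "\<lambda>y. (cmod (h y))\<^sup>2"] h_meas by (simp add: L2_space_def)
    have "L2_norm M f = L2_norm N h"
      unfolding L2_norm_def using f_h h_meas
      by (intro arg_cong[of _ _ sqrt] int_eq_on[of "\<lambda>y. (cmod (h y))\<^sup>2"]) auto
    moreover have "L2_inner M f (\<lambda>x. e j (\<tau> x)) = L2_inner N h (e j)" if "j \<in> J" for j
      unfolding L2_inner_def using f_h h_meas L2_space_measurable[OF e[OF that]]
      by (intro int_eq_on[of "\<lambda>y. h y * cnj (e j y)"]) auto
    moreover from this have "((\<lambda>j. (cmod (L2_inner M f (\<lambda>x. e j (\<tau> x))))\<^sup>2) has_sum (L2_norm N h)\<^sup>2) J \<longleftrightarrow>
        ((\<lambda>j. (cmod (L2_inner N h (e j)))\<^sup>2) has_sum (L2_norm N h)\<^sup>2) J"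
      by (intro has_sum_cong) simp
    ultimately show ?thesis
      using frame h by (simp only: parseval_frame_def)
  qed
  ultimately show ?thesis by (simp add: parseval_frame_def)
qed

text \<open>
  Extending a function on \<open>B\<close> by zero transfers it to any set that almost contains \<open>B\<close>.
\<close>

lemma lebesgue_on_almost_subset:
  fixes h :: "'a::euclidean_space \<Rightarrow> 'b::{banach, second_countable_topology}"
  assumes A: "A \<in> sets lebesgue" and B: "B \<in> sets lebesgue" and null: "B - A \<in> null_sets lebesgue"
    and h: "h \<in> borel_measurable (lebesgue_on B)"
  shows "(\<lambda>x. if x \<in> B then h x else 0) \<in> borel_measurable (lebesgue_on A)" (is ?measurable)
    and "integrable (lebesgue_on A) (\<lambda>x. if x \<in> B then h x else 0) \<longleftrightarrow> integrable (lebesgue_on B) h"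
      (is ?integrable)
    and "(\<integral>x. (if x \<in> B then h x else 0) \<partial>lebesgue_on A) = (\<integral>x. h x \<partial>lebesgue_on B)"
      (is ?integral)
proof -
  let ?h = "\<lambda>x. if x \<in> B then h x else 0"
  have ind: "(\<lambda>x. indicator B x *\<^sub>R h x) = ?h" by (auto simp: indicator_def)
  have meas: "?h \<in> borel_measurable lebesgue"
    using h B unfolding ind[symmetric] by (simp add: borel_measurable_restrict_space_iff)
  then show ?measurable by (rule measurable_restrict_space1)
  have meas_A: "(\<lambda>x. indicator A x *\<^sub>R ?h x) \<in> borel_measurable lebesgue"
    using meas A by simp
  have AE: "AE x in lebesgue. indicator A x *\<^sub>R ?h x = indicator B x *\<^sub>R h x"
    using AE_not_in[OF null] by eventually_elim (auto simp: indicator_def)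
  have meas_B: "(\<lambda>x. indicator B x *\<^sub>R h x) \<in> borel_measurable lebesgue"
    unfolding ind by (rule meas)
  show ?integrable
    using integrable_cong_AE[OF meas_A meas_B AE] A B by (simp add: integrable_restrict_space)
  show ?integral
    using integral_cong_AE[OF meas_A meas_B AE] A B by (simp add: integral_restrict_space)
qed

text \<open>
  This covers both the restriction of a frame to a subset and the replacement of a set by one that
  differs from it by a null set.
\<close>

lemma parseval_frame_lebesgue_on_almost_subset:
  fixes A B :: "'a::euclidean_space set"
  assumes A: "A \<in> sets lebesgue" and B: "B \<in> sets lebesgue" and null: "B - A \<in> null_sets lebesgue"
    and frame: "parseval_frame (lebesgue_on A) J e"
    and e: "\<And>j. j \<in> J \<Longrightarrow> e j \<in> L2_space (lebesgue_on B)"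
  shows "parseval_frame (lebesgue_on B) J e"
proof -
  note transfer = lebesgue_on_almost_subset[OF A B null]
  have "((\<lambda>j. (cmod (L2_inner (lebesgue_on B) f (e j)))\<^sup>2) has_sum (L2_norm (lebesgue_on B) f)\<^sup>2) J"
    if f: "f \<in> L2_space (lebesgue_on B)" for f
  proof -
    let ?f = "\<lambda>x. if x \<in> B then f x else 0"
    note f_meas = L2_space_measurable[OF f]
    have sq: "(\<lambda>x. (cmod (?f x))\<^sup>2) = (\<lambda>x. if x \<in> B then (cmod (f x))\<^sup>2 else 0)" by auto
    have sq_meas: "(\<lambda>x. (cmod (f x))\<^sup>2) \<in> borel_measurable (lebesgue_on B)" using f_meas by simp
    have "?f \<in> L2_space (lebesgue_on A)"
      using transfer(1)[OF f_meas] transfer(2)[OF sq_meas] L2_space_integrable[OF f]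
      by (simp add: L2_space_def sq)
    moreover have "L2_norm (lebesgue_on A) ?f = L2_norm (lebesgue_on B) f"
      unfolding L2_norm_def sq transfer(3)[OF sq_meas] ..
    moreover have "L2_inner (lebesgue_on A) ?f (e j) = L2_inner (lebesgue_on B) f (e j)" if "j \<in> J" for j
    proof -
      have "(\<lambda>x. f x * cnj (e j x)) \<in> borel_measurable (lebesgue_on B)"
        using f_meas L2_space_measurable[OF e[OF that]] by measurable
      note transfer(3)[OF this]
      moreover have "(\<lambda>x. ?f x * cnj (e j x)) = (\<lambda>x. if x \<in> B then f x * cnj (e j x) else 0)" by auto
      ultimately show ?thesis by (simp only: L2_inner_def)
    qed
    moreover from this have "((\<lambda>j. (cmod (L2_inner (lebesgue_on B) f (e j)))\<^sup>2) has_sum (L2_norm (lebesgue_on B) f)\<^sup>2) J \<longleftrightarrow>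
        ((\<lambda>j. (cmod (L2_inner (lebesgue_on A) ?f (e j)))\<^sup>2) has_sum (L2_norm (lebesgue_on B) f)\<^sup>2) J"
      by (intro has_sum_cong) (simp only:)
    moreover have "((\<lambda>j. (cmod (L2_inner (lebesgue_on A) ?f (e j)))\<^sup>2) has_sum (L2_norm (lebesgue_on A) ?f)\<^sup>2) J"
      using frame calculation(1) unfolding parseval_frame_def by blast
    ultimately show ?thesis by (simp only:)
  qed
  then show ?thesis using e by (simp add: parseval_frame_def)
qed

lemma
  fixes a :: "'a::euclidean_space"
  shows lebesgue_measurable_translation: "(\<lambda>x. x + a) \<in> lebesgue \<rightarrow>\<^sub>M lebesgue"
    and distr_lebesgue_translation: "distr lebesgue lebesgue (\<lambda>x. x + a) = lebesgue"
proof -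
  have T: "(\<lambda>x. a + (\<Sum>j\<in>Basis. (1 * (x \<bullet> j)) *\<^sub>R j)) = (\<lambda>x. x + a)"
    by (simp add: euclidean_representation add.commute)
  show "(\<lambda>x. x + a) \<in> lebesgue \<rightarrow>\<^sub>M lebesgue"
    using lebesgue_affine_measurable[of "\<lambda>_. 1" a] unfolding T by simp
  show "distr lebesgue lebesgue (\<lambda>x. x + a) = lebesgue"
    using lebesgue_affine_euclidean[of "\<lambda>_. 1" a] unfolding T by (simp add: density_1)
qed

lemma lebesgue_vimage_translation:
  fixes a :: "'a::euclidean_space"
  assumes "A \<in> sets lebesgue"
  shows "{x. x + a \<in> A} \<in> sets lebesgue" and "emeasure lebesgue {x. x + a \<in> A} = emeasure lebesgue A"
proof -
  have "(\<lambda>x. x + a) -` A \<inter> space lebesgue \<in> sets lebesgue"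
    by (rule measurable_sets[OF lebesgue_measurable_translation assms])
  moreover have "(\<lambda>x. x + a) -` A \<inter> space lebesgue = {x. x + a \<in> A}" by auto
  moreover have "emeasure lebesgue A = emeasure (distr lebesgue lebesgue (\<lambda>x. x + a)) A"
    by (simp only: distr_lebesgue_translation)
  ultimately show "{x. x + a \<in> A} \<in> sets lebesgue" "emeasure lebesgue {x. x + a \<in> A} = emeasure lebesgue A"
    using emeasure_distr[OF lebesgue_measurable_translation assms, of a] by simp_all
qed

text \<open>
  The bijection moves each of the countably many sets on which \<open>k\<close> is constant by a translation,
  and their images are disjoint; so it transports Lebesgue measure and measurability both ways.
\<close>

lemma piecewise_translation_isomorphism:
  fixes I J :: "real set" and k :: "real \<Rightarrow> int"
  assumes I: "I \<in> sets lebesgue" and J: "J \<in> sets lebesgue"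
    and bij: "bij_betw \<tau> I J" and k: "k \<in> measurable (lebesgue_on I) (count_space UNIV)"
    and translation: "\<forall>s\<in>I. \<tau> s = s + of_int (k s)"
  shows "\<tau> \<in> measurable (lebesgue_on I) (lebesgue_on J)"
    and "inv_into I \<tau> \<in> measurable (lebesgue_on J) (lebesgue_on I)"
    and "distr (lebesgue_on I) (lebesgue_on J) \<tau> = lebesgue_on J"
proof -
  let ?\<sigma> = "inv_into I \<tau>"
  note \<tau> = bspec[OF translation]
  define P where "P n = {s \<in> I. k s = n}" for n
  have P: "P n \<in> sets lebesgue" for n
  proof -
    have "k -` {n} \<inter> space (lebesgue_on I) \<in> sets (lebesgue_on I)"
      by (rule measurable_sets[OF k]) simp
    moreover have "k -` {n} \<inter> space (lebesgue_on I) = P n" using I by (auto simp: P_def)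
    ultimately show ?thesis using I by (simp add: sets_restrict_space_iff)
  qed
  have \<sigma>: "?\<sigma> x \<in> I" "\<tau> (?\<sigma> x) = x" if "x \<in> J" for x
    using bij that by (auto simp: bij_betw_def inv_into_into f_inv_into_f)
  have \<sigma>\<tau>: "?\<sigma> (\<tau> s) = s" if "s \<in> I" for s
    using bij that by (auto simp: bij_betw_def)
  have \<tau>J: "\<tau> s \<in> J" if "s \<in> I" for s using bij that by (auto simp: bij_betw_def)
  have \<tau>_vimage: "\<tau> -` A \<inter> I = (\<Union>n. P n \<inter> {s. s + of_int n \<in> A})" for A
    using \<tau> by (auto simp: P_def)
  have sets_\<tau>: "\<tau> -` A \<inter> I \<in> sets lebesgue" if "A \<in> sets lebesgue" for A
    unfolding \<tau>_vimage using P lebesgue_vimage_translation(1)[OF that] by (intro sets.countable_UN) auto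
  show \<tau>_meas: "\<tau> \<in> measurable (lebesgue_on I) (lebesgue_on J)"
  proof (rule measurableI)
    show "\<tau> s \<in> space (lebesgue_on J)" if "s \<in> space (lebesgue_on I)" for s
      using \<tau>J that by simp
    show "\<tau> -` A \<inter> space (lebesgue_on I) \<in> sets (lebesgue_on I)" if "A \<in> sets (lebesgue_on J)" for A
      using sets_\<tau>[of A] that I J by (simp add: sets_restrict_space_iff)
  qed
  have piece: "{x \<in> J. x + of_int (- n) \<in> P n} = {x. x + of_int (- n) \<in> P n}" for n
    using \<tau>J \<tau> by (force simp: P_def)
  show "?\<sigma> \<in> measurable (lebesgue_on J) (lebesgue_on I)"
  proof (rule measurableI)
    show "?\<sigma> x \<in> space (lebesgue_on I)" if "x \<in> space (lebesgue_on J)" for x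
      using \<sigma>(1) that by simp
    fix B assume "B \<in> sets (lebesgue_on I)"
    then have B: "B \<in> sets lebesgue" "B \<subseteq> I" using I by (auto simp: sets_restrict_space_iff)
    have "?\<sigma> -` B \<inter> J = (\<Union>n. {x. x + of_int (- n) \<in> B \<inter> P n})"
    proof (intro equalityI subsetI)
      fix x assume x: "x \<in> ?\<sigma> -` B \<inter> J"
      then have "x + of_int (- k (?\<sigma> x)) = ?\<sigma> x" using \<sigma>[of x] \<tau>[of "?\<sigma> x"] by auto
      then show "x \<in> (\<Union>n. {x. x + of_int (- n) \<in> B \<inter> P n})"
        using x \<sigma>[of x] by (auto simp: P_def intro!: exI[of _ "k (?\<sigma> x)"])
    next
      fix x assume "x \<in> (\<Union>n. {x. x + of_int (- n) \<in> B \<inter> P n})"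
      then obtain n where n: "x + of_int (- n) \<in> B" "x + of_int (- n) \<in> P n" by auto
      then have "\<tau> (x + of_int (- n)) = x" using \<tau> by (auto simp: P_def)
      then show "x \<in> ?\<sigma> -` B \<inter> J"
        using n \<sigma>\<tau>[of "x + of_int (- n)"] \<tau>J[of "x + of_int (- n)"] by (auto simp: P_def)
    qed
    also have "\<dots> \<in> sets lebesgue"
      using P B by (intro sets.countable_UN image_subsetI lebesgue_vimage_translation(1)) auto
    finally show "?\<sigma> -` B \<inter> space (lebesgue_on J) \<in> sets (lebesgue_on J)"
      using J by (simp add: sets_restrict_space_iff)
  qed
  show "distr (lebesgue_on I) (lebesgue_on J) \<tau> = lebesgue_on J"
  proof (rule measure_eqI)
    fix A assume "A \<in> sets (distr (lebesgue_on I) (lebesgue_on J) \<tau>)"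
    then have A_J: "A \<in> sets (lebesgue_on J)" by simp
    then have A: "A \<in> sets lebesgue" "A \<subseteq> J" using J by (auto simp: sets_restrict_space_iff)
    \<comment> \<open>\<open>X n\<close> is the part of the preimage of \<open>A\<close> that is shifted by \<open>n\<close>, and \<open>Y n\<close> its image.\<close>
    define X where "X n = P n \<inter> {s. s + of_int n \<in> A}" for n
    define Y where "Y n = {x. x + of_int (- n) \<in> X n}" for n
    have X: "X n \<in> sets lebesgue" for n
      unfolding X_def using P lebesgue_vimage_translation(1)[OF A(1)] by auto
    have Y: "Y n \<in> sets lebesgue" "emeasure lebesgue (Y n) = emeasure lebesgue (X n)" for n
      unfolding Y_def by (rule lebesgue_vimage_translation[OF X])+
    have Y_\<sigma>: "?\<sigma> x = x - of_int n \<and> k (?\<sigma> x) = n \<and> x \<in> A" if "x \<in> Y n" for x n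
    proof -
      have s: "x - of_int n \<in> I" "k (x - of_int n) = n" "x \<in> A"
        using that by (auto simp: Y_def X_def P_def)
      then have "\<tau> (x - of_int n) = x" using \<tau> by auto
      then show ?thesis using \<sigma>\<tau>[OF s(1)] s by auto
    qed
    have A_Y: "A = (\<Union>n. Y n)"
    proof (intro equalityI subsetI)
      fix x assume x: "x \<in> A"
      then have xJ: "x \<in> J" using A by auto
      have "x + of_int (- k (?\<sigma> x)) = ?\<sigma> x" using \<sigma>[OF xJ] \<tau>[of "?\<sigma> x"] by auto
      then have "x \<in> Y (k (?\<sigma> x))"
        using x \<sigma>[OF xJ] \<tau>[of "?\<sigma> x"] by (auto simp: Y_def X_def P_def)
      then show "x \<in> (\<Union>n. Y n)" by auto
    qed (use Y_\<sigma> in auto)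
    have "emeasure (distr (lebesgue_on I) (lebesgue_on J) \<tau>) A = emeasure (lebesgue_on I) (\<tau> -` A \<inter> I)"
      using \<tau>_meas A_J by (simp add: emeasure_distr)
    also have "\<dots> = emeasure lebesgue (\<Union>n. X n)"
      using I unfolding \<tau>_vimage X_def by (subst emeasure_restrict_space) (auto simp: P_def)
    also have "\<dots> = (\<integral>\<^sup>+n. emeasure lebesgue (X n) \<partial>count_space UNIV)"
      using X by (intro emeasure_UN_countable) (auto simp: disjoint_family_on_def X_def P_def)
    also have "\<dots> = (\<integral>\<^sup>+n. emeasure lebesgue (Y n) \<partial>count_space UNIV)"
      by (simp only: Y(2))
    also have "\<dots> = emeasure lebesgue (\<Union>n. Y n)"
    proof (rule emeasure_UN_countable[symmetric])
      show "disjoint_family Y"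
        unfolding disjoint_family_on_def using Y_\<sigma> by blast
    qed (use Y(1) in auto)
    also have "\<dots> = emeasure (lebesgue_on J) A"
      using J A by (simp add: A_Y[symmetric] emeasure_restrict_space)
    finally show "emeasure (distr (lebesgue_on I) (lebesgue_on J) \<tau>) A = emeasure (lebesgue_on J) A" .
  qed simp
qed

text \<open>
  The frame is restricted from the unit interval to \<open>J'\<close>, pulled back along \<open>\<tau>\<close> to \<open>I'\<close>, where
  the characters do not notice the integer shifts, and carried to \<open>I\<close> across a null set.
\<close>

theorem parseval_frame_fourier_char_translation_congruent:
  assumes I: "I \<in> sets lebesgue" and J: "J \<in> sets lebesgue" "J \<subseteq> {0..1}"
    and cong: "translation_congruent I J"
  shows "emeasure lebesgue I \<le> 1"
    and "parseval_frame (lebesgue_on I) UNIV fourier_char"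
proof -
  obtain I' J' \<tau> k where I': "I' \<in> sets lebesgue" and J': "J' \<in> sets lebesgue"
    and null_I: "sym_diff I I' \<in> null_sets lebesgue" and null_J: "sym_diff J J' \<in> null_sets lebesgue"
    and bij: "bij_betw \<tau> I' J'" and k: "k \<in> measurable (lebesgue_on I') (count_space UNIV)"
    and \<tau>: "\<forall>s\<in>I'. \<tau> s = s + of_int (k s)"
    using cong unfolding translation_congruent_def by blast
  note iso = piecewise_translation_isomorphism[OF I' J' bij k \<tau>]
  have ae: "emeasure lebesgue X = emeasure lebesgue Y"
    if "sym_diff X Y \<in> null_sets lebesgue" "X \<in> sets lebesgue" "Y \<in> sets lebesgue" for X Y :: "real set"
  proof (rule emeasure_eq_AE[OF _ that(2,3)])
    show "AE x in lebesgue. x \<in> X \<longleftrightarrow> x \<in> Y"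
      using AE_not_in[OF that(1)] by eventually_elim auto
  qed
  have J'_le: "emeasure lebesgue J' \<le> 1"
  proof -
    have "emeasure lebesgue J' = emeasure lebesgue J" using ae[OF null_J J(1) J'] by simp
    also have "\<dots> \<le> emeasure lebesgue {0..1::real}" by (intro emeasure_mono J) auto
    finally show ?thesis by simp
  qed
  have "emeasure lebesgue I = emeasure lebesgue I'" using ae[OF null_I I I'] .
  also have "\<dots> = emeasure (lebesgue_on I') (\<tau> -` J' \<inter> space (lebesgue_on I'))"
  proof -
    have "\<tau> -` J' \<inter> space (lebesgue_on I') = I'" using bij by (auto simp: bij_betw_def)
    then show ?thesis using I' by (simp add: emeasure_restrict_space del: emeasure_completion)
  qed
  also have "\<dots> = emeasure (distr (lebesgue_on I') (lebesgue_on J') \<tau>) J'"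
    using J' by (intro emeasure_distr[symmetric] iso) (auto simp: sets_restrict_space_iff)
  also have "\<dots> = emeasure lebesgue J'"
    unfolding iso(3) using J' by (simp add: emeasure_restrict_space del: emeasure_completion)
  finally show I_le: "emeasure lebesgue I \<le> 1" using J'_le by simp
  have char_L2: "fourier_char m \<in> L2_space (lebesgue_on S)"
    if "S \<in> sets lebesgue" "emeasure lebesgue S \<le> 1" for m S
  proof (rule L2_space_lebesgue_on_bounded[where B = 1, OF that(1)])
    show "emeasure lebesgue S < \<infinity>"
      using that(2) by (rule order_le_less_trans) simp
    show "fourier_char m \<in> borel_measurable (lebesgue_on S)"
      by (rule borel_measurable_lebesgue_on) simp
  qed simp
  have "parseval_frame (lebesgue_on J') UNIV fourier_char"
  proof (rule parseval_frame_lebesgue_on_almost_subset[OF _ J' _ parseval_frame_fourier_char])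
    show "J' - {0..1} \<in> null_sets lebesgue"
      by (rule null_sets_subset[OF null_J]) (use J J' in auto)
  qed (use char_L2[OF J' J'_le] in auto)
  then have "parseval_frame (lebesgue_on I') UNIV (\<lambda>m s. fourier_char m (\<tau> s))"
    by (rule parseval_frame_pullback[OF _ iso(1,3,2)]) (use bij in \<open>auto simp: bij_betw_def\<close>)
  then have "parseval_frame (lebesgue_on I') UNIV fourier_char"
    by (subst parseval_frame_cong) (auto simp: \<tau> fourier_char_add_int)
  then show "parseval_frame (lebesgue_on I) UNIV fourier_char"
  proof (rule parseval_frame_lebesgue_on_almost_subset[OF I' I, rotated])
    show "I - I' \<in> null_sets lebesgue"
      by (rule null_sets_subset[OF null_I]) (use I I' in auto)
  qed (use char_L2[OF I I_le] in auto)
qed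

section \<open>Fubini and Tonelli for Lebesgue measure on products and strips\<close>

text \<open>
  Lebesgue measure on a product is the completion of the product of the Lebesgue measures, not the
  product itself. The theorems of Fubini and Tonelli are transferred by replacing a function by a
  Borel one that agrees with it almost everywhere: then almost all slices agree almost everywhere.
\<close>

lemma borel_measurable_completion_cong_AE:
  fixes f g :: "'a \<Rightarrow> 'b::topological_space"
  assumes f: "f \<in> borel_measurable (completion M)" and ae: "AE x in M. f x = g x"
  shows "g \<in> borel_measurable (completion M)"
proof (rule measurableI)
  fix A :: "'b set" assume A: "A \<in> sets borel"
  show "g -` A \<inter> space (completion M) \<in> sets (completion M)"
  proof (rule completion.in_sets_AE)
    show "AE x in completion M. x \<in> f -` A \<inter> space (completion M) \<longleftrightarrow> x \<in> g -` A \<inter> space (completion M)"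
      using AE_completion[OF ae] by eventually_elim auto
  qed (use measurable_sets[OF f A] in auto)
qed simp

lemma completion_ex_borel_measurable_complex:
  fixes f :: "'a \<Rightarrow> complex"
  assumes f: "f \<in> borel_measurable (completion M)"
  shows "\<exists>f'\<in>borel_measurable M. AE x in M. f x = f' x"
proof -
  obtain u v where u: "u \<in> borel_measurable M" "AE x in M. Re (f x) = u x"
    and v: "v \<in> borel_measurable M" "AE x in M. Im (f x) = v x"
    using completion_ex_borel_measurable_real[of "\<lambda>x. Re (f x)" M]
      completion_ex_borel_measurable_real[of "\<lambda>x. Im (f x)" M] f by auto
  have "AE x in M. f x = Complex (u x) (v x)"
    using u(2) v(2) by eventually_elim (simp add: complex_eq_iff)
  moreover have "(\<lambda>x. Complex (u x) (v x)) \<in> borel_measurable M"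
    using u(1) v(1) by (simp add: Complex_eq)
  ultimately show ?thesis by (intro bexI[of _ "\<lambda>x. Complex (u x) (v x)"])
qed

lemma AE_lebesgue_pair:
  assumes "AE x in (lebesgue :: ('a::euclidean_space \<times> 'b::euclidean_space) measure). P x"
  shows "AE s in lborel. AE t in lborel. P (s, t)"
proof -
  have "AE x in lborel \<Otimes>\<^sub>M lborel. P x"
    unfolding lborel_prod using assms by (simp only: AE_completion_iff)
  then show ?thesis by (rule lborel_pair.AE_pair)
qed

lemma lebesgue_Tonelli:
  fixes f :: "'a::euclidean_space \<times> 'b::euclidean_space \<Rightarrow> ennreal"
  assumes f: "f \<in> borel_measurable lebesgue"
  shows "(\<lambda>s. \<integral>\<^sup>+t. f (s, t) \<partial>lebesgue) \<in> borel_measurable lebesgue"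
    and "(\<integral>\<^sup>+x. f x \<partial>lebesgue) = (\<integral>\<^sup>+s. \<integral>\<^sup>+t. f (s, t) \<partial>lebesgue \<partial>lebesgue)"
proof -
  obtain h where h: "h \<in> borel_measurable lborel" and ae: "AE x in lborel. f x = h x"
    using completion_ex_borel_measurable[OF f] by auto
  have h': "h \<in> borel_measurable (lborel \<Otimes>\<^sub>M lborel)" using h by (simp add: lborel_prod)
  have "AE s in lborel. AE t in lborel. f (s, t) = h (s, t)"
    using AE_lebesgue_pair[OF AE_completion[OF ae]] .
  then have eq: "AE s in lborel. (\<integral>\<^sup>+t. h (s, t) \<partial>lborel) = (\<integral>\<^sup>+t. f (s, t) \<partial>lebesgue)"
    by eventually_elim (auto simp: nn_integral_completion intro!: nn_integral_cong_AE)
  have "(\<lambda>s. \<integral>\<^sup>+t. h (s, t) \<partial>lborel) \<in> borel_measurable lborel"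
    by (rule lborel.borel_measurable_nn_integral_fst[OF h'])
  then show "(\<lambda>s. \<integral>\<^sup>+t. f (s, t) \<partial>lebesgue) \<in> borel_measurable lebesgue"
    by (intro borel_measurable_completion_cong_AE[OF measurable_completion eq])
  have "(\<integral>\<^sup>+x. f x \<partial>lebesgue) = (\<integral>\<^sup>+x. h x \<partial>lborel)"
    unfolding nn_integral_completion by (rule nn_integral_cong_AE[OF ae])
  also have "\<dots> = (\<integral>\<^sup>+s. \<integral>\<^sup>+t. h (s, t) \<partial>lborel \<partial>lborel)"
    using lborel.nn_integral_fst[OF h'] by (simp add: lborel_prod)
  also have "\<dots> = (\<integral>\<^sup>+s. \<integral>\<^sup>+t. f (s, t) \<partial>lebesgue \<partial>lebesgue)"
    unfolding nn_integral_completion[of lborel "\<lambda>s. \<integral>\<^sup>+t. f (s, t) \<partial>lebesgue"]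
    by (rule nn_integral_cong_AE[OF eq])
  finally show "(\<integral>\<^sup>+x. f x \<partial>lebesgue) = (\<integral>\<^sup>+s. \<integral>\<^sup>+t. f (s, t) \<partial>lebesgue \<partial>lebesgue)" .
qed

lemma lebesgue_AE_measurable_slice:
  fixes f :: "'a::euclidean_space \<times> 'b::euclidean_space \<Rightarrow> complex"
  assumes f: "f \<in> borel_measurable lebesgue"
  shows "AE s in lebesgue. (\<lambda>t. f (s, t)) \<in> borel_measurable lebesgue"
proof -
  obtain h where h: "h \<in> borel_measurable lborel" and ae: "AE x in lborel. f x = h x"
    using completion_ex_borel_measurable_complex[OF f] by auto
  have h': "h \<in> borel_measurable (borel \<Otimes>\<^sub>M borel)" using h by (simp add: borel_prod)
  have "AE s in lborel. AE t in lborel. f (s, t) = h (s, t)"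
    using AE_lebesgue_pair[OF AE_completion[OF ae]] .
  then have "AE s in lborel. (\<lambda>t. f (s, t)) \<in> borel_measurable lebesgue"
  proof eventually_elim
    case (elim s)
    have "(\<lambda>t. h (s, t)) \<in> borel_measurable lborel"
      using measurable_Pair2[OF h', of s] by simp
    then show ?case
      using elim by (intro borel_measurable_completion_cong_AE[OF measurable_completion]) (auto simp: eq_commute)
  qed
  then show ?thesis by (rule AE_completion)
qed

lemma lebesgue_Fubini:
  fixes f :: "'a::euclidean_space \<times> 'b::euclidean_space \<Rightarrow> complex"
  assumes f: "integrable lebesgue f"
  shows "integrable lebesgue (\<lambda>s. \<integral>t. f (s, t) \<partial>lebesgue)"
    and "(\<integral>x. f x \<partial>lebesgue) = (\<integral>s. \<integral>t. f (s, t) \<partial>lebesgue \<partial>lebesgue)"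
proof -
  obtain h where h: "h \<in> borel_measurable lborel" and ae: "AE x in lborel. f x = h x"
    using completion_ex_borel_measurable_complex[of f lborel] f by auto
  have h_leb: "h \<in> borel_measurable lebesgue" using h by (rule measurable_completion)
  have "integrable lebesgue h"
    using integrable_cong_AE[OF _ h_leb AE_completion[OF ae]] f by auto
  then have int_h: "integrable (lborel \<Otimes>\<^sub>M lborel) h"
    using h by (simp add: lborel_prod integrable_completion)
  have slices: "AE s in lborel. AE t in lborel. f (s, t) = h (s, t)"
    using AE_lebesgue_pair[OF AE_completion[OF ae]] .
  have h': "h \<in> borel_measurable (borel \<Otimes>\<^sub>M borel)" using h by (simp add: borel_prod)
  have eq: "AE s in lborel. (\<integral>t. h (s, t) \<partial>lborel) = (\<integral>t. f (s, t) \<partial>lebesgue)"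
    using slices
  proof eventually_elim
    case (elim s)
    have hs: "(\<lambda>t. h (s, t)) \<in> borel_measurable lborel"
      using measurable_Pair2[OF h', of s] by simp
    have hs': "(\<lambda>t. h (s, t)) \<in> borel_measurable lebesgue" by (rule measurable_completion[OF hs])
    have "AE t in lborel. h (s, t) = f (s, t)" using elim by (simp add: eq_commute)
    then have "(\<integral>t. h (s, t) \<partial>lebesgue) = (\<integral>t. f (s, t) \<partial>lebesgue)"
      using borel_measurable_completion_cong_AE[OF hs'] AE_completion by (intro integral_cong_AE hs') auto
    then show ?case using integral_completion[OF hs] by simp
  qed
  have int_slice: "integrable lborel (\<lambda>s. \<integral>t. h (s, t) \<partial>lborel)"
    by (rule lborel_pair.integrable_fst'[OF int_h])
  have meas_h: "(\<lambda>s. \<integral>t. h (s, t) \<partial>lborel) \<in> borel_measurable lebesgue"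
    using int_slice by (intro measurable_completion) auto
  have meas_f: "(\<lambda>s. \<integral>t. f (s, t) \<partial>lebesgue) \<in> borel_measurable lebesgue"
    by (rule borel_measurable_completion_cong_AE[OF meas_h eq])
  show "integrable lebesgue (\<lambda>s. \<integral>t. f (s, t) \<partial>lebesgue)"
    using integrable_cong_AE[OF meas_h meas_f AE_completion[OF eq]] int_slice
    by (simp add: integrable_completion borel_measurable_integrable)
  have "(\<integral>x. f x \<partial>lebesgue) = (\<integral>x. h x \<partial>lebesgue)"
    using f by (intro integral_cong_AE h_leb AE_completion[OF ae]) auto
  also have "\<dots> = (\<integral>x. h x \<partial>(lborel \<Otimes>\<^sub>M lborel))"
    by (simp only: integral_completion[OF h] lborel_prod)
  also have "\<dots> = (\<integral>s. \<integral>t. h (s, t) \<partial>lborel \<partial>lborel)"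
    by (rule lborel_pair.integral_fst'[OF int_h, symmetric])
  also have "\<dots> = (\<integral>s. \<integral>t. h (s, t) \<partial>lborel \<partial>lebesgue)"
    using int_slice by (intro integral_completion[symmetric]) auto
  also have "\<dots> = (\<integral>s. \<integral>t. f (s, t) \<partial>lebesgue \<partial>lebesgue)"
    by (intro integral_cong_AE meas_h meas_f AE_completion[OF eq])
  finally show "(\<integral>x. f x \<partial>lebesgue) = (\<integral>s. \<integral>t. f (s, t) \<partial>lebesgue \<partial>lebesgue)" .
qed

lemma lebesgue_strip_measurable:
  assumes "I \<in> sets (lebesgue :: 'a::euclidean_space measure)"
  shows "I \<times> (UNIV :: 'b::euclidean_space set) \<in> sets lebesgue"
proof -
  obtain B N N' where B: "I = B \<union> N" "N \<subseteq> N'" "N' \<in> null_sets lborel" "B \<in> sets borel"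
    using assms by (auto elim!: sets_completionE)
  have "B \<times> (UNIV :: 'b set) \<in> sets borel"
    unfolding borel_prod[symmetric] using B by (intro pair_measureI) auto
  then have "B \<times> (UNIV :: 'b set) \<in> sets lebesgue" by (intro sets_completionI_sets) simp
  moreover have "N' \<times> (UNIV :: 'b set) \<in> null_sets lebesgue"
  proof (rule null_sets_completionI)
    have "N' \<times> (UNIV :: 'b set) \<in> null_sets (lborel \<Otimes>\<^sub>M lborel)"
      using B(3) by (auto simp: null_sets_def lborel.emeasure_pair_measure_Times)
    then show "N' \<times> (UNIV :: 'b set) \<in> null_sets lborel" by (simp add: lborel_prod)
  qed
  then have "N \<times> (UNIV :: 'b set) \<in> sets lebesgue"
    using B(2) by (intro null_setsD2 completion.complete2[of "N \<times> UNIV" "N' \<times> UNIV"]) auto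
  ultimately have "B \<times> UNIV \<union> N \<times> (UNIV :: 'b set) \<in> sets lebesgue" by auto
  moreover have "B \<times> UNIV \<union> N \<times> (UNIV :: 'b set) = I \<times> UNIV" using B(1) by auto
  ultimately show ?thesis by simp
qed

context
  fixes I :: "'a::euclidean_space set"
  assumes I: "I \<in> sets lebesgue"
begin

lemma strip_Tonelli:
  fixes f :: "'a \<times> 'b::euclidean_space \<Rightarrow> ennreal"
  assumes f: "f \<in> borel_measurable (lebesgue_on (I \<times> UNIV))"
  shows "(\<lambda>s. \<integral>\<^sup>+t. f (s, t) \<partial>lebesgue) \<in> borel_measurable (lebesgue_on I)"
    and "(\<integral>\<^sup>+x. f x \<partial>lebesgue_on (I \<times> UNIV)) = (\<integral>\<^sup>+s. \<integral>\<^sup>+t. f (s, t) \<partial>lebesgue \<partial>lebesgue_on I)"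
proof -
  note strip = lebesgue_strip_measurable[OF I, where 'b = 'b]
  let ?f = "\<lambda>x. f x * indicator (I \<times> UNIV) x"
  have meas: "?f \<in> borel_measurable lebesgue"
    using f strip by (simp add: borel_measurable_restrict_space_iff_ennreal)
  have slice: "(\<integral>\<^sup>+t. ?f (s, t) \<partial>lebesgue) = (\<integral>\<^sup>+t. f (s, t) \<partial>lebesgue) * indicator I s" for s
    by (cases "s \<in> I") auto
  show "(\<lambda>s. \<integral>\<^sup>+t. f (s, t) \<partial>lebesgue) \<in> borel_measurable (lebesgue_on I)"
    using lebesgue_Tonelli(1)[OF meas] I unfolding slice
    by (simp add: borel_measurable_restrict_space_iff_ennreal)
  show "(\<integral>\<^sup>+x. f x \<partial>lebesgue_on (I \<times> UNIV)) = (\<integral>\<^sup>+s. \<integral>\<^sup>+t. f (s, t) \<partial>lebesgue \<partial>lebesgue_on I)"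
    using lebesgue_Tonelli(2)[OF meas] I strip unfolding slice
    by (simp add: nn_integral_restrict_space)
qed

lemma strip_AE_measurable_slice:
  fixes f :: "'a \<times> 'b::euclidean_space \<Rightarrow> complex"
  assumes f: "f \<in> borel_measurable (lebesgue_on (I \<times> UNIV))"
  shows "AE s in lebesgue_on I. (\<lambda>t. f (s, t)) \<in> borel_measurable lebesgue"
proof -
  note strip = lebesgue_strip_measurable[OF I, where 'b = 'b]
  have meas: "(\<lambda>x. indicator (I \<times> UNIV) x *\<^sub>R f x) \<in> borel_measurable lebesgue"
    using f strip by (simp add: borel_measurable_restrict_space_iff)
  have "AE s in lebesgue. s \<in> I \<longrightarrow> (\<lambda>t. f (s, t)) \<in> borel_measurable lebesgue"
    using lebesgue_AE_measurable_slice[OF meas] by eventually_elim auto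
  then show ?thesis using I by (simp add: AE_restrict_space_iff)
qed

lemma strip_Fubini:
  fixes f :: "'a \<times> 'b::euclidean_space \<Rightarrow> complex"
  assumes f: "integrable (lebesgue_on (I \<times> UNIV)) f"
  shows "integrable (lebesgue_on I) (\<lambda>s. \<integral>t. f (s, t) \<partial>lebesgue)"
    and "(\<integral>x. f x \<partial>lebesgue_on (I \<times> UNIV)) = (\<integral>s. \<integral>t. f (s, t) \<partial>lebesgue \<partial>lebesgue_on I)"
proof -
  note strip = lebesgue_strip_measurable[OF I, where 'b = 'b]
  have int: "integrable lebesgue (\<lambda>x. indicator (I \<times> UNIV) x *\<^sub>R f x)"
    using f strip by (simp add: integrable_restrict_space)
  have slice: "(\<integral>t. indicator (I \<times> UNIV) (s, t) *\<^sub>R f (s, t) \<partial>lebesgue) =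
      indicator I s *\<^sub>R (\<integral>t. f (s, t) \<partial>lebesgue)" for s
    by (cases "s \<in> I") auto
  show "integrable (lebesgue_on I) (\<lambda>s. \<integral>t. f (s, t) \<partial>lebesgue)"
    using lebesgue_Fubini(1)[OF int] I unfolding slice by (simp add: integrable_restrict_space)
  show "(\<integral>x. f x \<partial>lebesgue_on (I \<times> UNIV)) = (\<integral>s. \<integral>t. f (s, t) \<partial>lebesgue \<partial>lebesgue_on I)"
    using lebesgue_Fubini(2)[OF int] I strip unfolding slice by (simp add: integral_restrict_space)
qed

end

section \<open>A countable dense set on the line\<close>

text \<open>
  Finite combinations of indicators of intervals, with rational end points and complex rational
  coefficients. Lists serve as codes because they are countable.
\<close>

definition rational_step :: "((rat \<times> rat) \<times> rat \<times> rat) list \<Rightarrow> real \<Rightarrow> complex" where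
  "rational_step xs t =
     (\<Sum>((a, b), p, q)\<leftarrow>xs. Complex (of_rat a) (of_rat b) * indicator {of_rat p..of_rat q} t)"

lemma indicator_Icc_L2_lebesgue: "(indicator {a..b::real} :: real \<Rightarrow> complex) \<in> L2_space lebesgue"
proof (rule L2_spaceI_bound)
  show "(indicator {a..b} :: real \<Rightarrow> complex) \<in> borel_measurable lebesgue"
    by (intro measurable_completion) simp
  show "integrable lebesgue (indicator {a..b} :: real \<Rightarrow> real)"
    using integrable_indicator_Icc_lebesgue_on[of UNIV a b] by (simp add: lebesgue_on_UNIV_eq)
  show "AE x in lebesgue. (cmod (indicator {a..b} x))\<^sup>2 \<le> indicator {a..b} x"
    by (intro AE_I2) (simp add: indicator_def)
qed

lemma rational_step_L2: "rational_step xs \<in> L2_space lebesgue"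
proof (induction xs)
  case Nil
  have "rational_step [] = (\<lambda>t. 0)" by (simp add: rational_step_def fun_eq_iff)
  then show ?case by (simp add: L2_space_def)
next
  case (Cons x xs)
  obtain a b p q where x: "x = ((a, b), p, q)" by (metis surj_pair)
  have "rational_step (x # xs) =
      (\<lambda>t. Complex (of_rat a) (of_rat b) * indicator {of_rat p..of_rat q} t + rational_step xs t)"
    by (simp add: rational_step_def fun_eq_iff x)
  then show ?case using Cons by (simp only: L2_space_add L2_space_scale indicator_Icc_L2_lebesgue)
qed

lemma closure_complex_rationals: "closure (range (\<lambda>(a, b). Complex (of_rat a) (of_rat b))) = UNIV"
proof -
  have "z \<in> closure (range (\<lambda>(a, b). Complex (of_rat a) (of_rat b)))" for z
    unfolding closure_approachable
  proof (intro allI impI)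
    fix e :: real assume "e > 0"
    then obtain a b where ab: "Re z < of_rat a" "of_rat a < Re z + e / 2"
        "Im z < of_rat b" "of_rat b < Im z + e / 2"
      using of_rat_dense[of "Re z" "Re z + e / 2"] of_rat_dense[of "Im z" "Im z + e / 2"] by auto
    have "cmod (Complex (of_rat a) (of_rat b) - z) \<le> \<bar>of_rat a - Re z\<bar> + \<bar>of_rat b - Im z\<bar>"
      using cmod_le[of "Complex (of_rat a) (of_rat b) - z"] by simp
    also have "\<dots> < e" using ab by simp
    finally have "dist (Complex (of_rat a) (of_rat b)) z < e" by (simp add: dist_norm)
    then show "\<exists>y\<in>range (\<lambda>(a, b). Complex (of_rat a) (of_rat b)). dist y z < e" by auto
  qed
  then show ?thesis by auto
qed

lemma rational_step_dense: "L2_dense lebesgue (range rational_step)"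
proof (rule L2_denseI_closure)
  show D: "range rational_step \<subseteq> L2_space lebesgue" using rational_step_L2 by auto
  let ?V = "L2_closure lebesgue (range rational_step)"
  have V: "L2_closed_subspace lebesgue ?V"
  proof (rule L2_closed_subspace_closure[OF D _ _ _ closure_complex_rationals])
    have "rational_step [] = (\<lambda>x. 0)" by (simp add: rational_step_def fun_eq_iff)
    then show "(\<lambda>x. 0) \<in> range rational_step" by (metis rangeI)
    fix f g assume "f \<in> range rational_step" "g \<in> range rational_step"
    then obtain xs ys where "f = rational_step xs" "g = rational_step ys" by auto
    then have "(\<lambda>x. f x + g x) = rational_step (xs @ ys)" by (simp add: rational_step_def fun_eq_iff)
    then show "(\<lambda>x. f x + g x) \<in> range rational_step" by simp
  next
    fix z f assume "z \<in> range (\<lambda>(a, b). Complex (of_rat a) (of_rat b))" "f \<in> range rational_step"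
    then obtain c d xs where z: "z = Complex (of_rat c) (of_rat d)" and f: "f = rational_step xs" by auto
    have "z * rational_step xs t =
        rational_step (map (\<lambda>((a, b), I). ((c * a - d * b, c * b + d * a), I)) xs) t" for t
    proof (induction xs)
      case (Cons x xs)
      obtain a b p q where x: "x = ((a, b), p, q)" by (metis surj_pair)
      have "z * Complex (of_rat a) (of_rat b) = Complex (of_rat (c * a - d * b)) (of_rat (c * b + d * a))"
        by (simp add: z complex_eq_iff of_rat_mult of_rat_add of_rat_diff)
      then show ?case using Cons by (simp add: rational_step_def x distrib_left mult.assoc[symmetric])
    qed (simp add: rational_step_def)
    then have "(\<lambda>x. z * f x) = rational_step (map (\<lambda>((a, b), I). ((c * a - d * b, c * b + d * a), I)) xs)"
      by (auto simp: f)
    then show "(\<lambda>x. z * f x) \<in> range rational_step" by simp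
  qed
  have "(indicator {c..d} :: real \<Rightarrow> complex) \<in> ?V" for c d :: real
  proof -
    \<comment> \<open>Approximating from inside dominates all steps by the indicator of the limit interval, and is
      also right when that interval is empty.\<close>
    have "\<exists>p. c < real_of_rat p \<and> real_of_rat p < c + 1 / Suc n" for n
      using of_rat_dense[of c "c + 1 / Suc n"] by auto
    then obtain p where p: "\<And>n. c < real_of_rat (p n)" "\<And>n. real_of_rat (p n) < c + 1 / Suc n" by metis
    have "\<exists>q. d - 1 / Suc n < real_of_rat q \<and> real_of_rat q < d" for n
      using of_rat_dense[of "d - 1 / Suc n" d] by auto
    then obtain q where q: "\<And>n. d - 1 / Suc n < real_of_rat (q n)" "\<And>n. real_of_rat (q n) < d" by metis
    have inv0: "(\<lambda>n. 1 / real (Suc n)) \<longlonglongrightarrow> 0"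
      using LIMSEQ_inverse_real_of_nat by (simp add: inverse_eq_divide)
    have p_lim: "(\<lambda>n. real_of_rat (p n)) \<longlonglongrightarrow> c"
      by (rule tendsto_sandwich[of "\<lambda>n. c" _ _ "\<lambda>n. c + 1 / real (Suc n)"])
        (use p tendsto_add[OF tendsto_const inv0, of c] in \<open>auto intro!: always_eventually less_imp_le\<close>)
    have q_lim: "(\<lambda>n. real_of_rat (q n)) \<longlonglongrightarrow> d"
      by (rule tendsto_sandwich[of "\<lambda>n. d - 1 / real (Suc n)" _ _ "\<lambda>n. d"])
        (use q tendsto_diff[OF tendsto_const inv0, of d] in \<open>auto intro!: always_eventually less_imp_le\<close>)
    show ?thesis
    proof (rule L2_closed_subspace_dominated_limit[OF V,
          where F = "\<lambda>n. indicator {real_of_rat (p n)..real_of_rat (q n)}" and w = "indicator {c..d}"])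
      show "indicator {real_of_rat (p n)..real_of_rat (q n)} \<in> ?V" for n
      proof -
        have "(indicator {real_of_rat (p n)..real_of_rat (q n)} :: real \<Rightarrow> complex) =
            rational_step [((1, 0), p n, q n)]"
          by (simp add: rational_step_def fun_eq_iff flip: one_complex.code)
        then show ?thesis
          using L2_closure_superset[OF D] by auto
      qed
      show "(indicator {c..d} :: real \<Rightarrow> complex) \<in> borel_measurable lebesgue"
    by (intro measurable_completion) simp
      have "AE t in lborel. t \<noteq> c \<and> t \<noteq> d"
        by (intro AE_conjI AE_lborel_singleton)
      then have "AE t in lebesgue. t \<noteq> c \<and> t \<noteq> d" by (rule AE_completion)
      then show "AE t in lebesgue. (\<lambda>n. indicator {real_of_rat (p n)..real_of_rat (q n)} t :: complex)
          \<longlonglongrightarrow> indicator {c..d} t"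
      proof eventually_elim
        case (elim t)
        show ?case
        proof (cases "c < t \<and> t < d")
          case True
          then have "\<forall>\<^sub>F n in sequentially. real_of_rat (p n) < t \<and> t < real_of_rat (q n)"
            using order_tendstoD[OF p_lim] order_tendstoD[OF q_lim] by (auto intro: eventually_conj)
          then have "\<forall>\<^sub>F n in sequentially.
              indicator {real_of_rat (p n)..real_of_rat (q n)} t = (indicator {c..d} t :: complex)"
            by eventually_elim (use True in auto)
          then show ?thesis by (rule tendsto_eventually)
        next
          case False
          then have "t < c \<or> d < t" using elim by auto
          then have "indicator {real_of_rat (p n)..real_of_rat (q n)} t = (indicator {c..d} t :: complex)" for n
            using less_trans[OF _ p(1)[of n], of t] less_trans[OF q(2)[of n], of t] by auto
          then show ?thesis by simp
        qed
      qed
      have "(\<lambda>x. (indicator {c..d} x :: real)\<^sup>2) = indicator {c..d}"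
        by (auto simp: indicator_def fun_eq_iff)
      then show "integrable lebesgue (\<lambda>x. (indicator {c..d} x :: real)\<^sup>2)"
        using integrable_indicator_Icc_lebesgue_on[of UNIV c d] by (simp add: lebesgue_on_UNIV_eq)
      have "cmod (indicator {real_of_rat (p n)..real_of_rat (q n)} t) \<le> indicator {c..d} t" for n t
        using less_imp_le[OF p(1)[of n]] less_imp_le[OF q(2)[of n]] by (auto simp: indicator_def)
      then show "AE t in lebesgue. cmod (indicator {real_of_rat (p n)..real_of_rat (q n)} t) \<le> indicator {c..d} t" for n
        by simp
    qed
  qed
  then show "L2_space lebesgue \<subseteq> ?V"
    using L2_closed_subspace_lebesgue_on[of UNIV ?V] V by (simp add: lebesgue_on_UNIV_eq)
qed

section \<open>Frames that decompose over the fibres of a strip\<close>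

lemma lebesgue_on_strip_fst:
  assumes I: "I \<in> sets (lebesgue :: 'a::euclidean_space measure)"
  shows "fst \<in> lebesgue_on (I \<times> (UNIV :: 'b::euclidean_space set)) \<rightarrow>\<^sub>M lebesgue_on I"
proof (rule measurableI)
  fix A assume "A \<in> sets (lebesgue_on I)"
  then have A: "A \<in> sets lebesgue" "A \<subseteq> I" using I by (auto simp: sets_restrict_space_iff)
  have "fst -` A \<inter> space (lebesgue_on (I \<times> (UNIV :: 'b set))) = A \<times> UNIV" using A(2) by auto
  then show "fst -` A \<inter> space (lebesgue_on (I \<times> (UNIV :: 'b set))) \<in> sets (lebesgue_on (I \<times> UNIV))"
    using lebesgue_strip_measurable[OF A(1), where 'b = 'b] lebesgue_strip_measurable[OF I, where 'b = 'b] A(2)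
    by (auto simp: sets_restrict_space_iff)
qed auto

text \<open>
  Measurability for the completed sigma-algebra on the target needs that preimages of null sets are
  null.
\<close>

lemma lebesgue_on_strip_snd:
  "snd \<in> lebesgue_on (I \<times> (UNIV :: 'b::euclidean_space set)) \<rightarrow>\<^sub>M (lebesgue :: 'b measure)"
  for I :: "'a::euclidean_space set"
proof (rule measurable_restrict_space1, rule completion.measurable_completion2)
  show "snd \<in> (lebesgue :: ('a \<times> 'b) measure) \<rightarrow>\<^sub>M lborel"
    by (intro measurable_completion) (simp add: borel_prod[symmetric])
  show "null_sets lborel \<subseteq> null_sets (distr lebesgue lborel (snd :: 'a \<times> 'b \<Rightarrow> 'b))"
  proof
    fix N :: "'b set" assume N: "N \<in> null_sets lborel"
    have "(UNIV :: 'a set) \<times> N \<in> null_sets (lborel \<Otimes>\<^sub>M lborel)"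
      using N by (auto simp: null_sets_def lborel.emeasure_pair_measure_Times)
    then have "(UNIV :: 'a set) \<times> N \<in> null_sets lebesgue"
      unfolding lborel_prod by (rule null_sets_completionI)
    moreover have "snd -` N = (UNIV :: 'a set) \<times> N" by auto
    moreover have "snd \<in> (lebesgue :: ('a \<times> 'b) measure) \<rightarrow>\<^sub>M lborel"
      by (intro measurable_completion) (simp add: borel_prod[symmetric])
    ultimately show "N \<in> null_sets (distr lebesgue lborel (snd :: 'a \<times> 'b \<Rightarrow> 'b))"
      using N by (auto simp: null_sets_def emeasure_distr simp del: emeasure_completion)
  qed
qed

lemma borel_measurable_nn_integral_countable:
  fixes u :: "'i \<Rightarrow> 'a \<Rightarrow> ennreal"
  assumes J: "countable J" and u: "\<And>j. j \<in> J \<Longrightarrow> u j \<in> borel_measurable M"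
  shows "(\<lambda>x. \<integral>\<^sup>+j. u j x \<partial>count_space J) \<in> borel_measurable M"
proof -
  interpret sigma_finite_measure "count_space J" by (rule sigma_finite_measure_count_space_countable[OF J])
  have "(\<lambda>(j, x). u j x) \<in> borel_measurable (count_space J \<Otimes>\<^sub>M M)"
    using u by (intro measurable_pair_measure_countable1[OF J]) simp
  from borel_measurable_nn_integral_fst[OF measurable_pair_swap[OF this]] show ?thesis by simp
qed

lemma nn_integral_count_space_Times:
  assumes "countable A" "countable B"
  shows "(\<integral>\<^sup>+x. f x \<partial>count_space (A \<times> B)) = (\<integral>\<^sup>+a. \<integral>\<^sup>+b. f (a, b) \<partial>count_space B \<partial>count_space A)"
proof -
  interpret sigma_finite_measure "count_space B" by (rule sigma_finite_measure_count_space_countable[OF assms(2)])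
  show ?thesis
    by (subst nn_integral_fst) (simp_all add: pair_measure_countable assms)
qed

lemma strip_L2_slices:
  fixes f :: "'a::euclidean_space \<times> 'b::euclidean_space \<Rightarrow> complex"
  assumes I: "I \<in> sets lebesgue" and f: "f \<in> L2_space (lebesgue_on (I \<times> UNIV))"
  shows "AE s in lebesgue_on I. (\<lambda>t. f (s, t)) \<in> L2_space lebesgue"
    and "(\<integral>\<^sup>+s. ennreal ((L2_norm lebesgue (\<lambda>t. f (s, t)))\<^sup>2) \<partial>lebesgue_on I) =
      ennreal ((L2_norm (lebesgue_on (I \<times> UNIV)) f)\<^sup>2)"
proof -
  have f_meas: "f \<in> borel_measurable (lebesgue_on (I \<times> UNIV))" by (rule L2_space_measurable[OF f])
  then have sq_meas: "(\<lambda>x. ennreal ((cmod (f x))\<^sup>2)) \<in> borel_measurable (lebesgue_on (I \<times> UNIV))" by simp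
  note Tonelli = strip_Tonelli[OF I sq_meas]
  have "(\<integral>\<^sup>+s. \<integral>\<^sup>+t. ennreal ((cmod (f (s, t)))\<^sup>2) \<partial>lebesgue \<partial>lebesgue_on I) \<noteq> \<infinity>"
    unfolding Tonelli(2)[symmetric] nn_integral_L2[OF f] by simp
  then have "AE s in lebesgue_on I. (\<integral>\<^sup>+t. ennreal ((cmod (f (s, t)))\<^sup>2) \<partial>lebesgue) \<noteq> \<infinity>"
    using Tonelli(1) by (intro nn_integral_PInf_AE)
  then show slices: "AE s in lebesgue_on I. (\<lambda>t. f (s, t)) \<in> L2_space lebesgue"
    using strip_AE_measurable_slice[OF I f_meas]
  proof eventually_elim
    case (elim s)
    then show ?case by (simp add: L2_space_iff_nn_integral less_top)
  qed
  have "(\<integral>\<^sup>+s. ennreal ((L2_norm lebesgue (\<lambda>t. f (s, t)))\<^sup>2) \<partial>lebesgue_on I) =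
      (\<integral>\<^sup>+s. \<integral>\<^sup>+t. ennreal ((cmod (f (s, t)))\<^sup>2) \<partial>lebesgue \<partial>lebesgue_on I)"
  proof (rule nn_integral_cong_AE)
    show "AE s in lebesgue_on I. ennreal ((L2_norm lebesgue (\<lambda>t. f (s, t)))\<^sup>2) =
        (\<integral>\<^sup>+t. ennreal ((cmod (f (s, t)))\<^sup>2) \<partial>lebesgue)"
      using slices by eventually_elim (rule nn_integral_L2[symmetric])
  qed
  then show "(\<integral>\<^sup>+s. ennreal ((L2_norm lebesgue (\<lambda>t. f (s, t)))\<^sup>2) \<partial>lebesgue_on I) =
      ennreal ((L2_norm (lebesgue_on (I \<times> UNIV)) f)\<^sup>2)"
    unfolding Tonelli(2)[symmetric] nn_integral_L2[OF f] .
qed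

lemma strip_tensor_L2:
  assumes I: "I \<in> sets (lebesgue :: 'a::euclidean_space measure)" and finite: "emeasure lebesgue I < \<infinity>"
    and A: "A \<in> sets (lebesgue_on I)" and h: "h \<in> L2_space (lebesgue :: 'b::euclidean_space measure)"
  shows "(\<lambda>(s, t). indicator A s * h t) \<in> L2_space (lebesgue_on (I \<times> UNIV))"
proof -
  have meas: "(\<lambda>(s, t). indicator A s * h t) \<in> borel_measurable (lebesgue_on (I \<times> UNIV))"
  proof -
    have "(\<lambda>x. indicator A (fst x) :: complex) \<in> borel_measurable (lebesgue_on (I \<times> (UNIV :: 'b set)))"
      by (rule measurable_compose[OF lebesgue_on_strip_fst[OF I] borel_measurable_indicator[OF A]])
    moreover have "(\<lambda>x. h (snd x)) \<in> borel_measurable (lebesgue_on (I \<times> UNIV))"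
      by (rule measurable_compose[OF lebesgue_on_strip_snd L2_space_measurable[OF h]])
    ultimately show ?thesis unfolding case_prod_beta' by (rule borel_measurable_times)
  qed
  have sq_meas: "(\<lambda>x. ennreal ((cmod (case x of (s, t) \<Rightarrow> indicator A s * h t))\<^sup>2)) \<in>
      borel_measurable (lebesgue_on (I \<times> UNIV))"
    using meas by simp
  have "(\<integral>\<^sup>+x. ennreal ((cmod (case x of (s, t) \<Rightarrow> indicator A s * h t))\<^sup>2) \<partial>lebesgue_on (I \<times> UNIV)) =
      (\<integral>\<^sup>+s. \<integral>\<^sup>+t. ennreal ((cmod (indicator A s * h t))\<^sup>2) \<partial>lebesgue \<partial>lebesgue_on I)"
    using strip_Tonelli(2)[OF I sq_meas] by simp
  also have "\<dots> \<le> (\<integral>\<^sup>+s. ennreal ((L2_norm lebesgue h)\<^sup>2) \<partial>lebesgue_on I)"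
    unfolding nn_integral_L2[OF h, symmetric]
    by (intro nn_integral_mono) (auto simp: indicator_def)
  also have "\<dots> = ennreal ((L2_norm lebesgue h)\<^sup>2) * emeasure lebesgue I"
    using I by (simp add: emeasure_restrict_space del: emeasure_completion)
  also have "\<dots> < \<infinity>" using finite by (simp add: ennreal_mult_less_top del: emeasure_completion)
  finally show ?thesis using meas by (simp add: L2_space_iff_nn_integral)
qed

text \<open>
  \<open>e\<close> is a Parseval frame in the base variable, and \<open>\<Psi>\<close> is a family whose slices are tested for
  being a Parseval frame of L2 of the line. The bound on \<open>e\<close> keeps the products in L2 of the
  strip; the finite measure of the base puts \<open>indicator A s * h t\<close> into it.
\<close>

locale fibered_system =
  fixes I :: "'a::euclidean_space set" and J :: "'j set" and K :: "'k set"
    and e :: "'k \<Rightarrow> 'a \<Rightarrow> complex" and \<Psi> :: "'j \<Rightarrow> 'a \<times> real \<Rightarrow> complex"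
  assumes I: "I \<in> sets lebesgue" and finite_I: "emeasure lebesgue I < \<infinity>"
    and J: "countable J" and K: "countable K"
    and e_frame: "parseval_frame (lebesgue_on I) K e"
    and e_bounded: "\<And>k s. k \<in> K \<Longrightarrow> s \<in> I \<Longrightarrow> cmod (e k s) \<le> 1"
    and \<Psi>: "\<And>j. j \<in> J \<Longrightarrow> \<Psi> j \<in> L2_space (lebesgue_on (I \<times> UNIV))"
begin

abbreviation strip :: "('a \<times> real) measure" where "strip \<equiv> lebesgue_on (I \<times> UNIV)"

definition member :: "'j \<times> 'k \<Rightarrow> 'a \<times> real \<Rightarrow> complex" where
  "member = (\<lambda>(j, k) (s, t). e k s * \<Psi> j (s, t))"

definition coefficient :: "('a \<times> real \<Rightarrow> complex) \<Rightarrow> 'j \<Rightarrow> 'a \<Rightarrow> complex" where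
  "coefficient f j s = L2_inner lebesgue (\<lambda>t. f (s, t)) (\<lambda>t. \<Psi> j (s, t))"

lemma finite_measure_base: "finite_measure (lebesgue_on I)"
  using I finite_I by (intro finite_measureI) (auto simp: emeasure_restrict_space simp del: emeasure_completion)

lemma e_L2: "k \<in> K \<Longrightarrow> e k \<in> L2_space (lebesgue_on I)"
  using e_frame by (auto simp: parseval_frame_def)

lemma member_L2:
  assumes "j \<in> J" "k \<in> K"
  shows "member (j, k) \<in> L2_space strip"
proof -
  have "(\<lambda>x. e k (fst x)) \<in> borel_measurable strip"
    by (rule measurable_compose[OF lebesgue_on_strip_fst[OF I] L2_space_measurable[OF e_L2[OF assms(2)]]])
  then have "(\<lambda>x. e k (fst x) * \<Psi> j x) \<in> L2_space strip"
    using e_bounded[OF assms(2)] by (intro L2_space_bounded_mult[OF \<Psi>[OF assms(1)]]) auto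
  moreover have "(\<lambda>x. e k (fst x) * \<Psi> j x) = member (j, k)" by (auto simp: member_def)
  ultimately show ?thesis by simp
qed

lemma coefficient_measurable:
  assumes "f \<in> L2_space strip" "j \<in> J"
  shows "coefficient f j \<in> borel_measurable (lebesgue_on I)"
proof -
  have "integrable (lebesgue_on I) (\<lambda>s. \<integral>t. f (s, t) * cnj (\<Psi> j (s, t)) \<partial>lebesgue)"
    by (rule strip_Fubini(1)[OF I integrable_L2_product[OF assms(1) \<Psi>[OF assms(2)]]])
  then have "integrable (lebesgue_on I) (coefficient f j)"
    by (simp only: coefficient_def[abs_def] L2_inner_def)
  then show ?thesis by (rule borel_measurable_integrable)
qed

lemma L2_inner_member:
  assumes f: "f \<in> L2_space strip" and j: "j \<in> J" and k: "k \<in> K"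
  shows "L2_inner strip f (member (j, k)) = L2_inner (lebesgue_on I) (coefficient f j) (e k)"
proof -
  have "L2_inner strip f (member (j, k)) =
      (\<integral>s. \<integral>t. f (s, t) * cnj (member (j, k) (s, t)) \<partial>lebesgue \<partial>lebesgue_on I)"
    unfolding L2_inner_def by (rule strip_Fubini(2)[OF I integrable_L2_product[OF f member_L2[OF j k]]])
  also have "\<dots> = L2_inner (lebesgue_on I) (coefficient f j) (e k)"
    unfolding L2_inner_def
  proof (rule Bochner_Integration.integral_cong)
    fix s
    have "(\<lambda>t. f (s, t) * cnj (member (j, k) (s, t))) = (\<lambda>t. f (s, t) * cnj (\<Psi> j (s, t)) * cnj (e k s))"
      by (auto simp: member_def mult_ac)
    then show "(\<integral>t. f (s, t) * cnj (member (j, k) (s, t)) \<partial>lebesgue) = coefficient f j s * cnj (e k s)"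
      by (simp add: coefficient_def L2_inner_def)
  qed simp
  finally show ?thesis .
qed

text \<open>
  Square integrability of the coefficient functions is needed because the frame \<open>e\<close> is only known
  to satisfy the Parseval identity for square-integrable functions.
\<close>

lemma total_energy:
  assumes f: "f \<in> L2_space strip" and c: "\<forall>j\<in>J. coefficient f j \<in> L2_space (lebesgue_on I)"
  shows "(\<integral>\<^sup>+i. ennreal ((cmod (L2_inner strip f (member i)))\<^sup>2) \<partial>count_space (J \<times> K)) =
    (\<integral>\<^sup>+s. \<integral>\<^sup>+j. ennreal ((cmod (coefficient f j s))\<^sup>2) \<partial>count_space J \<partial>lebesgue_on I)"
proof -
  have "(\<integral>\<^sup>+i. ennreal ((cmod (L2_inner strip f (member i)))\<^sup>2) \<partial>count_space (J \<times> K)) =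
      (\<integral>\<^sup>+j. \<integral>\<^sup>+k. ennreal ((cmod (L2_inner (lebesgue_on I) (coefficient f j) (e k)))\<^sup>2)
        \<partial>count_space K \<partial>count_space J)"
    unfolding nn_integral_count_space_Times[OF J K]
    by (intro nn_integral_cong) (simp add: L2_inner_member[OF f])
  also have "\<dots> = (\<integral>\<^sup>+j. \<integral>\<^sup>+s. ennreal ((cmod (coefficient f j s))\<^sup>2) \<partial>lebesgue_on I \<partial>count_space J)"
  proof (rule nn_integral_cong)
    fix j assume "j \<in> space (count_space J)"
    then have cj: "coefficient f j \<in> L2_space (lebesgue_on I)" using c by simp
    have "((\<lambda>k. (cmod (L2_inner (lebesgue_on I) (coefficient f j) (e k)))\<^sup>2) has_sum
        (L2_norm (lebesgue_on I) (coefficient f j))\<^sup>2) K"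
      using e_frame cj by (simp add: parseval_frame_def)
    then show "(\<integral>\<^sup>+k. ennreal ((cmod (L2_inner (lebesgue_on I) (coefficient f j) (e k)))\<^sup>2) \<partial>count_space K) =
        (\<integral>\<^sup>+s. ennreal ((cmod (coefficient f j s))\<^sup>2) \<partial>lebesgue_on I)"
      unfolding nn_integral_L2[OF cj] by (subst has_sum_iff_nn_integral_count_space[symmetric]) auto
  qed
  also have "\<dots> = (\<integral>\<^sup>+s. \<integral>\<^sup>+j. ennreal ((cmod (coefficient f j s))\<^sup>2) \<partial>count_space J \<partial>lebesgue_on I)"
    using coefficient_measurable[OF f] by (intro nn_integral_count_space_nn_integral[symmetric] J) auto
  finally show ?thesis .
qed

text \<open>
  A single squared coefficient at \<open>s\<close> is at most the whole sum at \<open>s\<close>, which is the squared norm of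
  the slice; so the coefficient functions are square integrable.
\<close>

lemma frame_if_fiber_frames:
  assumes fibers: "AE s in lebesgue_on I. parseval_frame lebesgue J (\<lambda>j t. \<Psi> j (s, t))"
  shows "parseval_frame strip (J \<times> K) member"
proof -
  have "((\<lambda>i. (cmod (L2_inner strip f (member i)))\<^sup>2) has_sum (L2_norm strip f)\<^sup>2) (J \<times> K)"
    if f: "f \<in> L2_space strip" for f
  proof -
    have energy: "AE s in lebesgue_on I. (\<integral>\<^sup>+j. ennreal ((cmod (coefficient f j s))\<^sup>2) \<partial>count_space J) =
        ennreal ((L2_norm lebesgue (\<lambda>t. f (s, t)))\<^sup>2)"
      using fibers strip_L2_slices(1)[OF I f]
    proof eventually_elim
      case (elim s)
      then have "((\<lambda>j. (cmod (coefficient f j s))\<^sup>2) has_sum (L2_norm lebesgue (\<lambda>t. f (s, t)))\<^sup>2) J"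
        by (simp add: parseval_frame_def coefficient_def)
      then show ?case by (subst has_sum_iff_nn_integral_count_space[symmetric]) auto
    qed
    have c: "\<forall>j\<in>J. coefficient f j \<in> L2_space (lebesgue_on I)"
    proof
      fix j assume j: "j \<in> J"
      have "(\<integral>\<^sup>+s. ennreal ((cmod (coefficient f j s))\<^sup>2) \<partial>lebesgue_on I) \<le>
          (\<integral>\<^sup>+s. ennreal ((L2_norm lebesgue (\<lambda>t. f (s, t)))\<^sup>2) \<partial>lebesgue_on I)"
      proof (rule nn_integral_mono_AE)
        show "AE s in lebesgue_on I. ennreal ((cmod (coefficient f j s))\<^sup>2) \<le>
            ennreal ((L2_norm lebesgue (\<lambda>t. f (s, t)))\<^sup>2)"
          using energy
        proof eventually_elim
          case (elim s)
          show ?case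
            using nn_integral_ge_point[OF j, of "\<lambda>j. ennreal ((cmod (coefficient f j s))\<^sup>2)"]
            by (simp only: elim)
        qed
      qed
      also have "\<dots> < \<infinity>" unfolding strip_L2_slices(2)[OF I f] by simp
      finally show "coefficient f j \<in> L2_space (lebesgue_on I)"
        using coefficient_measurable[OF f j] by (simp add: L2_space_iff_nn_integral)
    qed
    have "(\<integral>\<^sup>+i. ennreal ((cmod (L2_inner strip f (member i)))\<^sup>2) \<partial>count_space (J \<times> K)) =
        (\<integral>\<^sup>+s. ennreal ((L2_norm lebesgue (\<lambda>t. f (s, t)))\<^sup>2) \<partial>lebesgue_on I)"
      unfolding total_energy[OF f c] by (rule nn_integral_cong_AE[OF energy])
    also have "\<dots> = ennreal ((L2_norm strip f)\<^sup>2)" by (rule strip_L2_slices(2)[OF I f])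
    finally show ?thesis by (subst has_sum_iff_nn_integral_count_space) auto
  qed
  then show ?thesis using member_L2 by (auto simp: parseval_frame_def)
qed

text \<open>
  The test functions \<open>indicator A s * h t\<close> localize the Parseval identity to arbitrary measurable
  subsets \<open>A\<close> of the base. Here the coefficient functions are square integrable by Cauchy-Schwarz
  on the fibres, since the norms of the slices of \<open>\<Psi> j\<close> are square integrable over the base.
\<close>

lemma fiber_parseval_if_frame:
  assumes frame: "parseval_frame strip (J \<times> K) member" and h: "h \<in> L2_space lebesgue"
  shows "AE s in lebesgue_on I.
    ((\<lambda>j. (cmod (L2_inner lebesgue h (\<lambda>t. \<Psi> j (s, t))))\<^sup>2) has_sum (L2_norm lebesgue h)\<^sup>2) J"
proof -
  interpret finite_measure "lebesgue_on I" by (rule finite_measure_base)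
  define f where "f A = (\<lambda>(s, t). indicator A s * h t)" for A :: "'a set"
  define c where "c j s = L2_inner lebesgue h (\<lambda>t. \<Psi> j (s, t))" for j s
  have f_L2: "f A \<in> L2_space strip" if "A \<in> sets (lebesgue_on I)" for A
    unfolding f_def by (rule strip_tensor_L2[OF I finite_I that h])
  have coeff_f: "coefficient (f A) j s = indicator A s * c j s" for A j s
    by (simp add: coefficient_def f_def c_def L2_inner_scale_left)
  have c_meas: "c j \<in> borel_measurable (lebesgue_on I)" if "j \<in> J" for j
  proof -
    have "I \<in> sets (lebesgue_on I)" using sets.top[of "lebesgue_on I"] by simp
    then have "coefficient (f I) j \<in> borel_measurable (lebesgue_on I)"
      by (rule coefficient_measurable[OF f_L2 that])
    then show ?thesis
      by (rule measurable_cong[THEN iffD1, rotated]) (simp add: coeff_f)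
  qed
  have c_L2: "c j \<in> L2_space (lebesgue_on I)" if j: "j \<in> J" for j
  proof -
    have "(\<integral>\<^sup>+s. ennreal ((cmod (c j s))\<^sup>2) \<partial>lebesgue_on I) \<le>
        (\<integral>\<^sup>+s. ennreal ((L2_norm lebesgue h)\<^sup>2) * ennreal ((L2_norm lebesgue (\<lambda>t. \<Psi> j (s, t)))\<^sup>2) \<partial>lebesgue_on I)"
    proof (rule nn_integral_mono_AE)
      show "AE s in lebesgue_on I. ennreal ((cmod (c j s))\<^sup>2) \<le>
          ennreal ((L2_norm lebesgue h)\<^sup>2) * ennreal ((L2_norm lebesgue (\<lambda>t. \<Psi> j (s, t)))\<^sup>2)"
        using strip_L2_slices(1)[OF I \<Psi>[OF j]]
      proof eventually_elim
        case (elim s)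
        have "(cmod (c j s))\<^sup>2 \<le> (L2_norm lebesgue h * L2_norm lebesgue (\<lambda>t. \<Psi> j (s, t)))\<^sup>2"
          unfolding c_def by (intro power_mono L2_Cauchy_Schwarz[OF h elim]) simp
        then show ?case by (simp add: power_mult_distrib flip: ennreal_mult)
      qed
    qed
    also have "\<dots> = ennreal ((L2_norm lebesgue h)\<^sup>2) * ennreal ((L2_norm strip (\<Psi> j))\<^sup>2)"
    proof -
      have "(\<lambda>x. ennreal ((cmod (\<Psi> j x))\<^sup>2)) \<in> borel_measurable strip"
        using L2_space_measurable[OF \<Psi>[OF j]] by simp
      from strip_Tonelli(1)[OF I this]
      have meas: "(\<lambda>s. \<integral>\<^sup>+t. ennreal ((cmod (\<Psi> j (s, t)))\<^sup>2) \<partial>lebesgue) \<in> borel_measurable (lebesgue_on I)" .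
      have "(\<integral>\<^sup>+s. ennreal ((L2_norm lebesgue h)\<^sup>2) * ennreal ((L2_norm lebesgue (\<lambda>t. \<Psi> j (s, t)))\<^sup>2) \<partial>lebesgue_on I) =
          (\<integral>\<^sup>+s. ennreal ((L2_norm lebesgue h)\<^sup>2) * (\<integral>\<^sup>+t. ennreal ((cmod (\<Psi> j (s, t)))\<^sup>2) \<partial>lebesgue) \<partial>lebesgue_on I)"
      proof (rule nn_integral_cong_AE)
        show "AE s in lebesgue_on I.
            ennreal ((L2_norm lebesgue h)\<^sup>2) * ennreal ((L2_norm lebesgue (\<lambda>t. \<Psi> j (s, t)))\<^sup>2) =
            ennreal ((L2_norm lebesgue h)\<^sup>2) * (\<integral>\<^sup>+t. ennreal ((cmod (\<Psi> j (s, t)))\<^sup>2) \<partial>lebesgue)"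
          using strip_L2_slices(1)[OF I \<Psi>[OF j]] by eventually_elim (simp only: nn_integral_L2)
      qed
      also have "\<dots> = ennreal ((L2_norm lebesgue h)\<^sup>2) *
          (\<integral>\<^sup>+s. \<integral>\<^sup>+t. ennreal ((cmod (\<Psi> j (s, t)))\<^sup>2) \<partial>lebesgue \<partial>lebesgue_on I)"
        by (rule nn_integral_cmult[OF meas])
      finally show ?thesis
        using strip_Tonelli(2)[OF I \<open>(\<lambda>x. ennreal ((cmod (\<Psi> j x))\<^sup>2)) \<in> borel_measurable strip\<close>]
          nn_integral_L2[OF \<Psi>[OF j]] by simp
    qed
    also have "\<dots> < \<infinity>" by (simp add: ennreal_mult_less_top)
    finally show ?thesis using c_meas[OF j] by (simp add: L2_space_iff_nn_integral)
  qed
  \<comment> \<open>The two sides are the sum of the squared coefficients of \<open>f A\<close> and its squared norm.\<close>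
  have energy_indicator: "(\<integral>\<^sup>+s. (\<integral>\<^sup>+j. ennreal ((cmod (c j s))\<^sup>2) \<partial>count_space J) * indicator A s \<partial>lebesgue_on I) =
      (\<integral>\<^sup>+s. ennreal ((L2_norm lebesgue h)\<^sup>2) * indicator A s \<partial>lebesgue_on I)"
    if A: "A \<in> sets (lebesgue_on I)" for A
  proof -
    have coeff_L2: "\<forall>j\<in>J. coefficient (f A) j \<in> L2_space (lebesgue_on I)"
    proof
      fix j assume "j \<in> J"
      then have "(\<lambda>s. indicator A s * c j s) \<in> L2_space (lebesgue_on I)"
        by (intro L2_space_bounded_mult c_L2 borel_measurable_indicator A) (simp_all add: indicator_def)
      then show "coefficient (f A) j \<in> L2_space (lebesgue_on I)" by (simp only: coeff_f[abs_def])
    qed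
    have "((\<lambda>i. (cmod (L2_inner strip (f A) (member i)))\<^sup>2) has_sum (L2_norm strip (f A))\<^sup>2) (J \<times> K)"
      using frame f_L2[OF A] by (simp add: parseval_frame_def)
    then have "(\<integral>\<^sup>+i. ennreal ((cmod (L2_inner strip (f A) (member i)))\<^sup>2) \<partial>count_space (J \<times> K)) =
        ennreal ((L2_norm strip (f A))\<^sup>2)"
      by (subst has_sum_iff_nn_integral_count_space[symmetric]) auto
    then have eq: "(\<integral>\<^sup>+s. \<integral>\<^sup>+j. ennreal ((cmod (coefficient (f A) j s))\<^sup>2) \<partial>count_space J \<partial>lebesgue_on I) =
        (\<integral>\<^sup>+s. ennreal ((L2_norm lebesgue (\<lambda>t. f A (s, t)))\<^sup>2) \<partial>lebesgue_on I)"
      unfolding total_energy[OF f_L2[OF A] coeff_L2] strip_L2_slices(2)[OF I f_L2[OF A]] .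
    have "(\<integral>\<^sup>+j. ennreal ((cmod (coefficient (f A) j s))\<^sup>2) \<partial>count_space J) =
        (\<integral>\<^sup>+j. ennreal ((cmod (c j s))\<^sup>2) \<partial>count_space J) * indicator A s" for s
      by (simp add: coeff_f indicator_def)
    moreover have "ennreal ((L2_norm lebesgue (\<lambda>t. f A (s, t)))\<^sup>2) =
        ennreal ((L2_norm lebesgue h)\<^sup>2) * indicator A s" for s
      by (simp add: f_def L2_norm_scale indicator_def)
    ultimately show ?thesis using eq by (simp only:)
  qed
  have "AE s in lebesgue_on I. (\<integral>\<^sup>+j. ennreal ((cmod (c j s))\<^sup>2) \<partial>count_space J) = ennreal ((L2_norm lebesgue h)\<^sup>2)"
  proof (rule density_unique_finite_measure)
    show "(\<lambda>s. \<integral>\<^sup>+j. ennreal ((cmod (c j s))\<^sup>2) \<partial>count_space J) \<in> borel_measurable (lebesgue_on I)"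
      using c_meas by (intro borel_measurable_nn_integral_countable J) auto
  qed (use energy_indicator in auto)
  then show ?thesis
  proof eventually_elim
    case (elim s)
    then show ?case
      unfolding c_def by (subst has_sum_iff_nn_integral_count_space) auto
  qed
qed

theorem fiber_frames_iff_frame:
  "(AE s in lebesgue_on I. parseval_frame lebesgue J (\<lambda>j t. \<Psi> j (s, t))) \<longleftrightarrow>
    parseval_frame strip (J \<times> K) member"
proof
  assume frame: "parseval_frame strip (J \<times> K) member"
  have "AE s in lebesgue_on I. \<forall>d\<in>range rational_step.
      ((\<lambda>j. (cmod (L2_inner lebesgue d (\<lambda>t. \<Psi> j (s, t))))\<^sup>2) has_sum (L2_norm lebesgue d)\<^sup>2) J"
    by (intro AE_ball_countable' fiber_parseval_if_frame[OF frame]) (auto simp: rational_step_L2)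
  moreover have "AE s in lebesgue_on I. \<forall>j\<in>J. (\<lambda>t. \<Psi> j (s, t)) \<in> L2_space lebesgue"
    by (intro AE_ball_countable' strip_L2_slices(1)[OF I] \<Psi> J)
  ultimately show "AE s in lebesgue_on I. parseval_frame lebesgue J (\<lambda>j t. \<Psi> j (s, t))"
  proof eventually_elim
    case (elim s)
    show ?case
      by (rule parseval_frame_if_dense[OF _ rational_step_dense]) (use elim in auto)
  qed
qed (rule frame_if_fiber_frames)

end

section \<open>From the weighted strip to fibres\<close>

lemma parseval_frame_reindex:
  assumes p: "bij_betw p J' J"
  shows "parseval_frame M J' (\<lambda>i. \<psi> (p i)) \<longleftrightarrow> parseval_frame M J \<psi>"
proof -
  have "(\<forall>i\<in>J'. \<psi> (p i) \<in> L2_space M) \<longleftrightarrow> (\<forall>j\<in>J. \<psi> j \<in> L2_space M)"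
    using p by (auto simp: bij_betw_def)
  moreover have "((\<lambda>i. (cmod (L2_inner M f (\<psi> (p i))))\<^sup>2) has_sum c) J' \<longleftrightarrow>
      ((\<lambda>j. (cmod (L2_inner M f (\<psi> j)))\<^sup>2) has_sum c) J" for f c
    by (rule has_sum_reindex_bij_betw[OF p])
  ultimately show ?thesis by (simp add: parseval_frame_def)
qed

text \<open>
  Multiplication by the square root of a positive weight is a unitary map from the weighted to the
  unweighted space; positivity makes it surjective.
\<close>

lemma parseval_frame_density:
  fixes M :: "'a measure" and w :: "'a \<Rightarrow> real"
    and f :: "'a \<Rightarrow> complex" and \<psi> :: "'j \<Rightarrow> 'a \<Rightarrow> complex"
  assumes w: "w \<in> borel_measurable M" and positive: "\<forall>x\<in>space M. 0 < w x"
  shows "f \<in> L2_space (density M (\<lambda>x. ennreal (w x))) \<longleftrightarrow> (\<lambda>x. sqrt (w x) * f x) \<in> L2_space M"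
      (is "?L2 f")
    and "parseval_frame (density M (\<lambda>x. ennreal (w x))) J \<psi> \<longleftrightarrow>
      parseval_frame M J (\<lambda>j x. sqrt (w x) * \<psi> j x)" (is ?frame)
proof -
  let ?N = "density M (\<lambda>x. ennreal (w x))"
  let ?u = "\<lambda>f x. complex_of_real (sqrt (w x)) * f x"
  note pos = bspec[OF positive]
  have AE_pos: "AE x in M. 0 \<le> w x" using pos by (auto intro!: AE_I2 less_imp_le)
  have meas_iff: "f \<in> borel_measurable M \<longleftrightarrow> ?u f \<in> borel_measurable M" for f
  proof
    assume "?u f \<in> borel_measurable M"
    then have "(\<lambda>x. ?u f x / complex_of_real (sqrt (w x))) \<in> borel_measurable M" using w by measurable
    then show "f \<in> borel_measurable M"
      by (rule measurable_cong[THEN iffD1, rotated]) (use pos in \<open>force simp: less_imp_neq\<close>)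
  qed (use w in measurable)
  have sq: "w x *\<^sub>R (cmod (f x))\<^sup>2 = (cmod (?u f x))\<^sup>2" if "x \<in> space M" for f x
    using pos[OF that] by (simp add: norm_mult power_mult_distrib)
  have L2_iff: "?L2 f" for f
  proof (cases "f \<in> borel_measurable M")
    case True
    then have "integrable ?N (\<lambda>x. (cmod (f x))\<^sup>2) \<longleftrightarrow> integrable M (\<lambda>x. w x *\<^sub>R (cmod (f x))\<^sup>2)"
      using w AE_pos by (intro integrable_density) auto
    also have "\<dots> \<longleftrightarrow> integrable M (\<lambda>x. (cmod (?u f x))\<^sup>2)"
      by (intro Bochner_Integration.integrable_cong refl sq)
    finally show ?thesis using True meas_iff by (simp add: L2_space_def)
  next
    case False
    then show ?thesis using meas_iff by (auto simp: L2_space_def)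
  qed
  show "?L2 f" by (rule L2_iff)
  have norm_eq: "L2_norm ?N f = L2_norm M (?u f)" if "f \<in> borel_measurable M" for f
  proof -
    have "(\<integral>x. (cmod (f x))\<^sup>2 \<partial>?N) = (\<integral>x. w x *\<^sub>R (cmod (f x))\<^sup>2 \<partial>M)"
      using that w AE_pos by (intro integral_density) auto
    also have "\<dots> = (\<integral>x. (cmod (?u f x))\<^sup>2 \<partial>M)"
      by (intro Bochner_Integration.integral_cong refl sq)
    finally show ?thesis by (simp only: L2_norm_def)
  qed
  have inner_eq: "L2_inner ?N f g = L2_inner M (?u f) (?u g)"
    if "f \<in> borel_measurable M" "g \<in> borel_measurable M" for f g
  proof -
    have "(\<integral>x. f x * cnj (g x) \<partial>?N) = (\<integral>x. w x *\<^sub>R (f x * cnj (g x)) \<partial>M)"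
      using that w AE_pos by (intro integral_density) auto
    also have "\<dots> = (\<integral>x. ?u f x * cnj (?u g x) \<partial>M)"
    proof (rule Bochner_Integration.integral_cong)
      fix x assume "x \<in> space M"
      then have "complex_of_real (w x) = complex_of_real (sqrt (w x)) * complex_of_real (sqrt (w x))"
        using pos[of x] by (simp flip: of_real_mult)
      then show "w x *\<^sub>R (f x * cnj (g x)) = ?u f x * cnj (?u g x)"
        by (simp add: scaleR_conv_of_real)
    qed simp
    finally show ?thesis by (simp only: L2_inner_def)
  qed
  show ?frame
  proof (cases "\<forall>j\<in>J. \<psi> j \<in> L2_space ?N")
    case False
    then show ?thesis by (auto simp: parseval_frame_def L2_iff)
  next
    case True
    then have \<psi>_meas: "\<psi> j \<in> borel_measurable M" if "j \<in> J" for j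
      using that L2_space_measurable by fastforce
    have equation: "((\<lambda>j. (cmod (L2_inner ?N f (\<psi> j)))\<^sup>2) has_sum (L2_norm ?N f)\<^sup>2) J \<longleftrightarrow>
        ((\<lambda>j. (cmod (L2_inner M (?u f) (?u (\<psi> j))))\<^sup>2) has_sum (L2_norm M (?u f))\<^sup>2) J"
      if "f \<in> L2_space ?N" for f
    proof -
      have f: "f \<in> borel_measurable M" using L2_space_measurable[OF that] by simp
      show ?thesis unfolding norm_eq[OF f] by (intro has_sum_cong) (simp only: inner_eq[OF f \<psi>_meas])
    qed
    have "(\<forall>f\<in>L2_space ?N. ((\<lambda>j. (cmod (L2_inner M (?u f) (?u (\<psi> j))))\<^sup>2) has_sum (L2_norm M (?u f))\<^sup>2) J) \<longleftrightarrow>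
        (\<forall>\<phi>\<in>L2_space M. ((\<lambda>j. (cmod (L2_inner M \<phi> (?u (\<psi> j))))\<^sup>2) has_sum (L2_norm M \<phi>)\<^sup>2) J)"
    proof (intro iffI ballI)
      fix \<phi> assume all: "\<forall>f\<in>L2_space ?N. ((\<lambda>j. (cmod (L2_inner M (?u f) (?u (\<psi> j))))\<^sup>2) has_sum (L2_norm M (?u f))\<^sup>2) J"
        and \<phi>: "\<phi> \<in> L2_space M"
      let ?f = "\<lambda>x. \<phi> x / complex_of_real (sqrt (w x))"
      have u_f: "?u ?f x = \<phi> x" if "x \<in> space M" for x using pos[OF that] by simp
      have "(\<lambda>x. ?u ?f x) \<in> L2_space M"
      proof (rule L2_space_cong_AE[OF \<phi>])
        show "AE x in M. \<phi> x = ?u ?f x" using u_f by (intro AE_I2) simp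
        show "(\<lambda>x. ?u ?f x) \<in> borel_measurable M" using L2_space_measurable[OF \<phi>] w by measurable
      qed
      then have "?f \<in> L2_space ?N" by (simp only: L2_iff)
      moreover have "L2_norm M (?u ?f) = L2_norm M \<phi>"
        unfolding L2_norm_def using u_f by (intro arg_cong[of _ _ sqrt] Bochner_Integration.integral_cong) auto
      moreover have "L2_inner M (?u ?f) (?u (\<psi> j)) = L2_inner M \<phi> (?u (\<psi> j))" for j
        unfolding L2_inner_def using u_f by (intro Bochner_Integration.integral_cong) auto
      ultimately show "((\<lambda>j. (cmod (L2_inner M \<phi> (?u (\<psi> j))))\<^sup>2) has_sum (L2_norm M \<phi>)\<^sup>2) J"
        using bspec[OF all, of ?f] by (simp only:)
    qed (simp add: L2_iff)
    then show ?thesis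
      using True by (simp add: parseval_frame_def L2_iff[symmetric] equation)
  qed
qed

lemma L2_space_translation:
  fixes a :: "'a::euclidean_space"
  assumes S: "S \<in> sets lebesgue" "\<And>x. x + a \<in> S \<longleftrightarrow> x \<in> S" and f: "f \<in> L2_space (lebesgue_on S)"
  shows "(\<lambda>x. f (x + a)) \<in> L2_space (lebesgue_on S)"
proof -
  let ?M = "lebesgue_on S" and ?T = "\<lambda>x. x + a"
  have vimage: "?T -` A \<inter> S = {x. x + a \<in> A}" if "A \<subseteq> S" for A
    using that S(2) by auto
  have T: "?T \<in> measurable ?M ?M"
  proof (rule measurableI)
    show "?T -` A \<inter> space ?M \<in> sets ?M" if "A \<in> sets ?M" for A
      using that S lebesgue_vimage_translation(1)[of A a] by (auto simp: sets_restrict_space_iff vimage)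
  qed (use S in auto)
  have "distr ?M ?M ?T = ?M"
  proof (rule measure_eqI)
    fix A assume "A \<in> sets (distr ?M ?M ?T)"
    then have A: "A \<in> sets ?M" "A \<in> sets lebesgue" "A \<subseteq> S" using S(1) by (auto simp: sets_restrict_space_iff)
    have "emeasure (distr ?M ?M ?T) A = emeasure ?M {x. x + a \<in> A}"
      using emeasure_distr[OF T A(1)] vimage[OF A(3)] by simp
    also have "\<dots> = emeasure lebesgue {x. x + a \<in> A}"
      using S A by (intro emeasure_restrict_space) auto
    also have "\<dots> = emeasure lebesgue A"
      by (rule lebesgue_vimage_translation(2)[OF A(2)])
    also have "\<dots> = emeasure ?M A"
      using S A by (intro emeasure_restrict_space[symmetric]) auto
    finally show "emeasure (distr ?M ?M ?T) A = emeasure ?M A" .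
  qed simp
  moreover have "(\<lambda>x. (cmod (f x))\<^sup>2) \<in> borel_measurable ?M"
    using L2_space_measurable[OF f] by measurable
  ultimately have "integrable ?M (\<lambda>x. (cmod (f (x + a)))\<^sup>2)"
    using integrable_distr_eq[OF T, of "\<lambda>x. (cmod (f x))\<^sup>2"] L2_space_integrable[OF f] by simp
  moreover have "(\<lambda>x. f (x + a)) \<in> borel_measurable ?M"
    by (rule measurable_compose[OF T L2_space_measurable[OF f]])
  ultimately show ?thesis by (simp add: L2_space_def)
qed

theorem proposition3p3:
  fixes I :: "real set" and \<alpha> \<beta> :: real and g :: "real \<times> real \<Rightarrow> complex"
  assumes "I \<in> sets lebesgue" and "I \<subseteq> UNIV - {0}"
    and "\<exists>J\<in>sets lebesgue. J \<subseteq> {0..1} \<and> translation_congruent I J"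
    and "\<alpha> > 0" and "\<beta> > 0"
    and "g \<in> L2_space (weighted_strip I)"
  shows "gabor_field I \<alpha> \<beta> g \<longleftrightarrow>
    parseval_frame (weighted_strip I) (int_multiples \<alpha> \<times> int_multiples \<beta> \<times> (UNIV :: int set))
      (\<lambda>(k, l, m). T_hat k l m g)"
proof -
  let ?strip = "lebesgue_on (I \<times> (UNIV :: real set))"
  let ?A = "int_multiples \<alpha>" and ?B = "int_multiples \<beta>"
  define \<Psi> :: "real \<times> real \<Rightarrow> real \<times> real \<Rightarrow> complex" where
    "\<Psi> = (\<lambda>(k :: real, l :: real) (s :: real, t :: real). sqrt \<bar>s\<bar> * exp (- 2 * pi * \<i> * s * l * t) * g (s, t - k))"
  define \<Phi> :: "real \<times> real \<times> int \<Rightarrow> real \<times> real \<Rightarrow> complex" where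
    "\<Phi> i x = sqrt \<bar>fst x\<bar> * (\<lambda>(k, l, m). T_hat k l m g) i x" for i x
  \<comment> \<open>The index \<open>m\<close> is separated from \<open>(k, l)\<close>, which index the fibre systems.\<close>
  define assoc :: "(real \<times> real) \<times> int \<Rightarrow> real \<times> real \<times> int" where
    "assoc = (\<lambda>((k, l), m). (k, l, m))"
  have strip_sets: "I \<times> (UNIV :: real set) \<in> sets lebesgue"
    by (rule lebesgue_strip_measurable[OF assms(1)])
  obtain J where J: "J \<in> sets lebesgue" "J \<subseteq> {0..1}" "translation_congruent I J"
    using assms(3) by auto
  note char = parseval_frame_fourier_char_translation_congruent[OF assms(1) J]
  have weight: "weighted_strip I = density ?strip (\<lambda>x. ennreal \<bar>fst x\<bar>)"
    by (simp add: weighted_strip_def case_prod_beta')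
  have weight_meas: "(\<lambda>x. \<bar>fst x\<bar>) \<in> borel_measurable ?strip"
    by (intro borel_measurable_lebesgue_on borel_measurable_continuous_onI continuous_intros)
  have weight_pos: "\<forall>x\<in>space ?strip. 0 < \<bar>fst x\<bar>"
    using assms(2) by auto
  note unweight = parseval_frame_density[OF weight_meas weight_pos, folded weight]
  have g_L2: "(\<lambda>x. sqrt \<bar>fst x\<bar> * g x) \<in> L2_space ?strip"
    using assms(6) unweight(1) by blast
  have \<Psi>_L2: "\<Psi> j \<in> L2_space ?strip" for j
  proof -
    obtain k l where j: "j = (k, l)" by (cases j)
    have "(\<lambda>x. sqrt \<bar>fst (x + (0, - k))\<bar> * g (x + (0, - k))) \<in> L2_space ?strip"
      by (rule L2_space_translation[OF strip_sets _ g_L2]) auto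
    then have "(\<lambda>x. exp (- 2 * pi * \<i> * complex_of_real (fst x) * l * complex_of_real (snd x)) *
        (sqrt \<bar>fst (x + (0, - k))\<bar> * g (x + (0, - k)))) \<in> L2_space ?strip"
    proof (rule L2_space_bounded_mult)
      show "(\<lambda>x. exp (- 2 * pi * \<i> * complex_of_real (fst x) * l * complex_of_real (snd x))) \<in> borel_measurable ?strip"
        by (intro borel_measurable_lebesgue_on borel_measurable_continuous_onI continuous_intros)
    qed simp
    moreover have "(\<lambda>x. exp (- 2 * pi * \<i> * complex_of_real (fst x) * l * complex_of_real (snd x)) *
        (sqrt \<bar>fst (x + (0, - k))\<bar> * g (x + (0, - k)))) = \<Psi> j"
      by (auto simp: \<Psi>_def j mult_ac)
    ultimately show ?thesis by simp
  qed
  interpret fibered_system I "?A \<times> ?B" "UNIV :: int set" fourier_char \<Psi>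
  proof
    show "emeasure lebesgue I < \<infinity>" using char(1) by (rule order_le_less_trans) simp
    show "countable (?A \<times> ?B)" by (auto simp: int_multiples_def)
  qed (use assms(1) char(2) \<Psi>_L2 in auto)
  have "gabor_field I \<alpha> \<beta> g \<longleftrightarrow>
      (AE s in lebesgue_on I. parseval_frame lebesgue (?A \<times> ?B) (\<lambda>j t. \<Psi> j (s, t)))"
  proof -
    have "(\<lambda>(k :: real, l :: real) t. sqrt \<bar>s\<bar> * exp (- 2 * pi * \<i> * s * l * t) * g (s, t - k)) = (\<lambda>j t. \<Psi> j (s, t))" for s
      by (auto simp: \<Psi>_def)
    then show ?thesis using assms(6) by (simp add: gabor_field_def)
  qed
  also have "\<dots> \<longleftrightarrow> parseval_frame ?strip ((?A \<times> ?B) \<times> UNIV) member"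
    by (rule fiber_frames_iff_frame)
  also have "\<dots> \<longleftrightarrow> parseval_frame ?strip ((?A \<times> ?B) \<times> UNIV) (\<lambda>i. \<Phi> (assoc i))"
    unfolding member_def
    by (intro parseval_frame_cong)
      (auto simp: \<Phi>_def assoc_def \<Psi>_def T_hat_def fourier_char_def mult_ac)
  also have "\<dots> \<longleftrightarrow> parseval_frame ?strip (?A \<times> ?B \<times> UNIV) \<Phi>"
  proof (rule parseval_frame_reindex)
    show "bij_betw assoc ((?A \<times> ?B) \<times> UNIV) (?A \<times> ?B \<times> UNIV)"
      unfolding assoc_def by (rule bij_betw_byWitness[where f' = "\<lambda>(k, l, m). ((k, l), m)"]) auto
  qed
  also have "\<dots> \<longleftrightarrow> parseval_frame (weighted_strip I) (?A \<times> ?B \<times> UNIV) (\<lambda>(k, l, m). T_hat k l m g)"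
    unfolding \<Phi>_def[abs_def] by (rule unweight(2)[symmetric])
  finally show ?thesis .
qed

end
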